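(* Let $s>0$ be irrational and let $G=(\mathbb Z/4)*(\mathbb Z/4)$. Suppose that $g\in G^0$ has the form $g=h^2$ where $h$ has word length $n=4m+2$. Then the action of $\widehat g_s$ on $\mathbb T^4$ is conjugate, by a piecewise translation, to the restriction of a $(2n)$-dimensional double lattice PET to a finite invariant union of $4$-dimensional convex polytopes.
   Context: Let $A_1,A_2$ be the standard generators of $G=(\mathbb Z/4)*(\mathbb Z/4)$; $G^0$ is the index $4$ subgroup of words whose total exponent is divisible by $4$. Word length is counted in positive letters: $h$ is written as a product of $n$ letters, each equal to $A_1$ or $A_2$. $\mathbb T^4=\mathbb C^2/(\mathbb Z[i])^2$, and $Q^2\subset\mathbb C$ is the open unit square centered at $0$. The action of $G$ on $\mathbb T^4$ by almost everywhere defined piecewise affine maps sends $A_1$ to $\widehat R_1(w_1,w_2)=(iw_1,\;w_2+(-1+i)w_1/s) \bmod (\mathbb Z[i])^2$, where the representative $w_1\in Q^2$ is used, and $A_2$ to $\widehat R_2(w_1,w_2)=(w_1+(-1+i)sw_2,\;iw_2)\bmod (\mathbb Z[i])^2$, where the representative $w_2\in Q^2$ is used. $\widehat g_s$ denotes the map by which $g$ acts. Double lattice PETs. The data is a quadruple $(X_1,X_2,\Lambda_1,\Lambda_2)$ where $X_1,X_2$ are polytopes in $\mathbb R^d$, $\Lambda_1,\Lambda_2$ are lattices in $\mathbb R^d$, and for all $i,j\in\{1,2\}$, $X_i$ is a fundamental domain for $\Lambda_j$ (the $\Lambda_j$-translates of $X_i$ cover $\mathbb R^d$ and have pairwise disjoint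 interiors). For $i\neq j$ define $f_{ij}:X_i\to X_j$ almost everywhere by $f_{ij}(p)=p+\lambda_p$, where $\lambda_p\in\Lambda_j$ is the (generically unique) vector with $p+\lambda_p\in X_j$. The double lattice PET is the system $(X_1,f)$ with $f=f_{21}\circ f_{12}:X_1\to X_1$; it is $d$-dimensional. Here $d=2n$ and $\mathbb R^{2n}=\mathbb C^n$. In speaking of a piecewise translation from $\mathbb T^4$ into $\mathbb C^n$, $\mathbb T^4$ is identified with its image under an injective linear map $\mathbb C^2\to\mathbb C^n$ each of whose coordinates is $w_1$ or $w_2$ (repeating coordinates); the conjugacy is, on each of finitely many polytopes partitioning $\mathbb T^4$, this map followed by a translation. All statements are understood where the maps are defined. *)

theory Defs
  imports "HOL-Analysis.Analysis" "HOL-Algebra.Group"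
begin

datatype gen = A1 | A2

text \<open>
  The free product of two copies of the cyclic group of order 4 is presented by
  \<open>\<langle>A1, A2 | A1^4 = A2^4 = 1\<rangle>\<close>.  Since the inverse of a generator is its cube, positive words
  suffice: the group consists of positive words up to insertion and deletion of fourth powers.
\<close>

definition cancel_step :: "gen list \<Rightarrow> gen list \<Rightarrow> bool" where
  "cancel_step xs ys \<longleftrightarrow> (\<exists>u v a. xs = u @ replicate 4 a @ v \<and> ys = u @ v)"

definition word_eq :: "gen list \<Rightarrow> gen list \<Rightarrow> bool" where
  "word_eq = equivclp cancel_step"

lemma equivp_word_eq: "equivp word_eq"
  unfolding word_eq_def by (rule equivp_evquivclp)

quotient_type z4z4 = "gen list" / word_eq
  morphisms rep_z4z4 of_word
  by (rule equivp_word_eq)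

lemma word_eq_induct [consumes 1, case_names refl sym trans step]:
  assumes "word_eq xs ys"
    and "\<And>xs. P xs xs" and "\<And>xs ys. P xs ys \<Longrightarrow> P ys xs"
    and "\<And>xs ys zs. P xs ys \<Longrightarrow> P ys zs \<Longrightarrow> P xs zs"
    and "\<And>u v a. P (u @ replicate 4 a @ v) (u @ v)"
  shows "P xs ys"
  using assms(1) unfolding word_eq_def
proof (induction rule: equivclp_induct)
  case base
  show ?case by (rule assms(2))
next
  case (step y z)
  then have "P y z"
    using assms(3,5) unfolding cancel_step_def by blast
  with step show ?case using assms(4) by blast
qed

lemma word_eq_step: "word_eq (u @ replicate 4 a @ v) (u @ v)"
  unfolding word_eq_def by (intro r_into_equivclp) (auto simp: cancel_step_def)

lemma word_eq_append_right: "word_eq xs ys \<Longrightarrow> word_eq (xs @ zs) (ys @ zs)"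
proof (induction rule: word_eq_induct)
  case (step u v a)
  show ?case using word_eq_step[of u a "v @ zs"] by simp
qed (use equivp_word_eq in \<open>blast intro: equivp_reflp equivp_symp equivp_transp\<close>)+

lemma word_eq_append_left: "word_eq xs ys \<Longrightarrow> word_eq (zs @ xs) (zs @ ys)"
proof (induction rule: word_eq_induct)
  case (step u v a)
  show ?case using word_eq_step[of "zs @ u" a v] by simp
qed (use equivp_word_eq in \<open>blast intro: equivp_reflp equivp_symp equivp_transp\<close>)+

lift_definition z4z4_mult :: "z4z4 \<Rightarrow> z4z4 \<Rightarrow> z4z4" is "(@)"
  using equivp_transp[OF equivp_word_eq] word_eq_append_left word_eq_append_right by blast

definition G :: "z4z4 monoid" where
  "G = \<lparr>carrier = UNIV, monoid.mult = z4z4_mult, one = of_word []\<rparr>"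

lemma of_word_append: "of_word (xs @ ys) = of_word xs \<otimes>\<^bsub>G\<^esub> of_word ys"
  by (simp add: G_def z4z4_mult.abs_eq)

lemma group_G: "group G"
proof (rule groupI)
  fix x assume "x \<in> carrier G"
  obtain xs where x: "x = of_word xs"
    by (metis Quotient_abs_rep[OF Quotient_z4z4])
  have "\<exists>ys. of_word (ys @ xs) = of_word []" for xs
  proof (induction xs)
    case Nil
    show ?case by (rule exI[of _ "[]"]) simp
  next
    case (Cons a xs)
    then obtain ys where ys: "of_word (ys @ xs) = of_word []" by blast
    have "of_word ((ys @ replicate 3 a) @ a # xs) = of_word (ys @ replicate 4 a @ xs)"
      by (simp add: numeral_eq_Suc)
    also have "\<dots> = of_word (ys @ xs)"
      by (simp add: z4z4.abs_eq_iff word_eq_step)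
    finally show ?case using ys by metis
  qed
  then obtain ys where "of_word (ys @ xs) = of_word []" by blast
  then show "\<exists>y\<in>carrier G. y \<otimes>\<^bsub>G\<^esub> x = \<one>\<^bsub>G\<^esub>"
    unfolding x of_word_append by (auto simp: G_def)
qed (auto simp: G_def, (transfer; simp add: equivp_reflp[OF equivp_word_eq])+)

definition has_word_length :: "z4z4 \<Rightarrow> nat \<Rightarrow> bool" where
  "has_word_length h n \<longleftrightarrow> (\<exists>xs. length xs = n \<and> h = of_word xs)"

definition G0 :: "z4z4 set" where
  "G0 = {of_word xs |xs. 4 dvd length xs}"

definition gauss2 :: "(complex \<times> complex) set" where
  "gauss2 = {(a, b). Re a \<in> \<int> \<and> Im a \<in> \<int> \<and> Re b \<in> \<int> \<and> Im b \<in> \<int>}"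

quotient_type torus4 = "complex \<times> complex" / "\<lambda>w w'. w - w' \<in> gauss2"
  morphisms rep_torus4 torus
proof (rule equivpI)
  show "reflp (\<lambda>w w'. w - w' \<in> gauss2)"
    by (auto simp: reflp_def gauss2_def zero_prod_def)
  show "symp (\<lambda>w w'. w - w' \<in> gauss2)"
  proof (rule sympI)
    fix w w' assume "w - w' \<in> gauss2"
    then have "- (w - w') \<in> gauss2"
      unfolding gauss2_def by (auto simp del: minus_diff_eq simp: case_prod_unfold)
    then show "w' - w \<in> gauss2" by simp
  qed
  show "transp (\<lambda>w w'. w - w' \<in> gauss2)"
  proof (rule transpI)
    fix x y z assume "x - y \<in> gauss2" "y - z \<in> gauss2"
    then have "(x - y) + (y - z) \<in> gauss2"
      unfolding gauss2_def case_prod_unfold mem_Collect_eq fst_add snd_add plus_complex.simps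
      by (intro conjI Ints_add) auto
    then show "x - z \<in> gauss2" by simp
  qed
qed

lemma torus_eq_iff: "torus w = torus w' \<longleftrightarrow> w - w' \<in> gauss2"
  by (rule torus4.abs_eq_iff)

definition open_square :: "complex set" where
  "open_square = {z. \<bar>Re z\<bar> < 1/2 \<and> \<bar>Im z\<bar> < 1/2}"

fun turned_coord :: "gen \<Rightarrow> complex \<times> complex \<Rightarrow> complex" where
  "turned_coord A1 w = fst w"
| "turned_coord A2 w = snd w"

fun turn_lift :: "real \<Rightarrow> gen \<Rightarrow> complex \<times> complex \<Rightarrow> complex \<times> complex" where
  "turn_lift s A1 (w1, w2) = (\<i> * w1, w2 + (-1 + \<i>) * w1 / of_real s)"
| "turn_lift s A2 (w1, w2) = (w1 + (-1 + \<i>) * of_real s * w2, \<i> * w2)"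

text \<open>
  Almost everywhere defined maps are partial functions.  The representative below is unique
  up to a Gaussian integer in the coordinate that is not turned, so the result is unique.
\<close>

definition turn :: "real \<Rightarrow> gen \<Rightarrow> torus4 \<rightharpoonup> torus4" where
  "turn s a p =
     (if \<exists>w. torus w = p \<and> turned_coord a w \<in> open_square
      then Some (torus (turn_lift s a (SOME w. torus w = p \<and> turned_coord a w \<in> open_square)))
      else None)"

fun word_map :: "real \<Rightarrow> gen list \<Rightarrow> torus4 \<rightharpoonup> torus4" where
  "word_map s [] = Some"
| "word_map s (a # xs) = turn s a \<circ>\<^sub>m word_map s xs"

lemma open_square_int_eq:
  assumes "x \<in> open_square" "y \<in> open_square" "Re (x - y) \<in> \<int>" "Im (x - y) \<in> \<int>"
  shows "x = y"
proof -
  have "\<bar>Re (x - y)\<bar> < 1" "\<bar>Im (x - y)\<bar> < 1"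
    using assms(1,2) unfolding open_square_def by auto
  then have "Re (x - y) = 0" "Im (x - y) = 0"
    using Ints_eq_abs_less1[OF assms(3) Ints_0] Ints_eq_abs_less1[OF assms(4) Ints_0] by auto
  then show ?thesis by (simp add: complex_eq_iff)
qed

lemma turn_torus:
  assumes "turned_coord a w \<in> open_square"
  shows "turn s a (torus w) = Some (torus (turn_lift s a w))"
proof -
  define w' where "w' = (SOME w'. torus w' = torus w \<and> turned_coord a w' \<in> open_square)"
  have "torus w' = torus w \<and> turned_coord a w' \<in> open_square"
    unfolding w'_def by (rule someI[of _ w]) (use assms in simp)
  then have w': "w' - w \<in> gauss2" "turned_coord a w' \<in> open_square"
    by (auto simp: torus_eq_iff)
  then have "turned_coord a w' = turned_coord a w"
    using assms by (cases a) (auto intro!: open_square_int_eq simp: gauss2_def case_prod_unfold)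
  then have "turn_lift s a w' - turn_lift s a w \<in> gauss2"
    using w'(1) by (cases a; cases w; cases w') (auto simp: gauss2_def case_prod_unfold)
  then have "torus (turn_lift s a w') = torus (turn_lift s a w)"
    by (simp add: torus_eq_iff)
  moreover have "\<exists>w'. torus w' = torus w \<and> turned_coord a w' \<in> open_square"
    using assms by blast
  ultimately show ?thesis
    unfolding turn_def w'_def by simp
qed

lemma turn_None:
  "turn s a p = None \<longleftrightarrow> \<not> (\<exists>w. torus w = p \<and> turned_coord a w \<in> open_square)"
  by (simp add: turn_def)

lemma turned_coord_turn_lift: "turned_coord a (turn_lift s a w) = \<i> * turned_coord a w"
  by (cases a; cases w) auto

lemma ii_mult_open_square: "z \<in> open_square \<Longrightarrow> \<i> * z \<in> open_square"
  by (simp add: open_square_def)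

lemma turn_lift_4: "turn_lift s a (turn_lift s a (turn_lift s a (turn_lift s a w))) = w"
  by (cases a; cases w) (auto simp: algebra_simps add_divide_distrib diff_divide_distrib)

text \<open>
  Extending the maps by the identity turns the almost everywhere defined action into a total
  one; this shows that all words for the same group element agree wherever they are defined.
\<close>

definition total_turn :: "real \<Rightarrow> gen \<Rightarrow> torus4 \<Rightarrow> torus4" where
  "total_turn s a p = (case turn s a p of None \<Rightarrow> p | Some q \<Rightarrow> q)"

lemma total_turn_4: "total_turn s a (total_turn s a (total_turn s a (total_turn s a p))) = p"
proof (cases "turn s a p")
  case None
  then show ?thesis by (simp add: total_turn_def)
next
  case (Some q)
  then obtain w where w: "torus w = p" "turned_coord a w \<in> open_square"
    using turn_None[of s a p] by auto
  have *: "total_turn s a (torus w) = torus (turn_lift s a w)"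
    if "turned_coord a w \<in> open_square" for w
    by (simp add: total_turn_def turn_torus that)
  have **: "turned_coord a (turn_lift s a w) \<in> open_square"
    if "turned_coord a w \<in> open_square" for w
    unfolding turned_coord_turn_lift using that by (rule ii_mult_open_square)
  from w(2) show ?thesis
    unfolding w(1)[symmetric] by (simp only: * ** turn_lift_4)
qed

lemma foldr_total_turn:
  "word_eq xs ys \<Longrightarrow> foldr (total_turn s) xs p = foldr (total_turn s) ys p"
  by (induction rule: word_eq_induct) (simp_all add: numeral_eq_Suc total_turn_4)

lemma word_map_foldr: "word_map s xs p = Some q \<Longrightarrow> foldr (total_turn s) xs p = q"
  by (induction xs arbitrary: q) (auto simp: map_comp_Some_iff total_turn_def)

lemma word_map_unique:
  assumes "of_word xs = of_word ys" "word_map s xs p = Some q" "word_map s ys p = Some r"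
  shows "q = r"
  using assms foldr_total_turn word_map_foldr by (metis z4z4.abs_eq_iff)

text \<open>
  The map of a group element is defined at a point if the map of some word representing it is.
  By \<open>word_map_unique\<close>, the value does not depend on the chosen word.
\<close>

definition act :: "real \<Rightarrow> z4z4 \<Rightarrow> torus4 \<rightharpoonup> torus4" where
  "act s g p =
     (if \<exists>xs. of_word xs = g \<and> p \<in> dom (word_map s xs)
      then word_map s (SOME xs. of_word xs = g \<and> p \<in> dom (word_map s xs)) p
      else None)"

lemma act_of_word:
  assumes "word_map s xs p = Some q"
  shows "act s (of_word xs) p = Some q"
proof -
  define ys where "ys = (SOME ys. of_word ys = of_word xs \<and> p \<in> dom (word_map s ys))"
  have ex: "\<exists>ys. of_word ys = of_word xs \<and> p \<in> dom (word_map s ys)"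
    using assms by blast
  then have ys: "of_word ys = of_word xs \<and> p \<in> dom (word_map s ys)"
    unfolding ys_def by (rule someI_ex)
  then obtain r where "word_map s ys p = Some r" by blast
  with ys assms word_map_unique have "word_map s ys p = Some q" by blast
  then show ?thesis
    using ex unfolding act_def ys_def by simp
qed

definition is_lattice :: "'a::euclidean_space set \<Rightarrow> bool" where
  "is_lattice L \<longleftrightarrow> (\<exists>B. independent B \<and> span B = UNIV \<and>
     L = {(\<Sum>b\<in>B. of_int (c b) *\<^sub>R b) |c :: 'a \<Rightarrow> int. True})"

definition fundamental_domain :: "'a::euclidean_space set \<Rightarrow> 'a set \<Rightarrow> bool" where
  "fundamental_domain L X \<longleftrightarrow>
     (\<Union>l\<in>L. (+) l ` X) = UNIV \<and>
     (\<forall>l\<in>L. \<forall>l'\<in>L. l \<noteq> l' \<longrightarrow> interior ((+) l ` X) \<inter> interior ((+) l' ` X) = {})"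

definition double_lattice ::
    "'a::euclidean_space set \<Rightarrow> 'a set \<Rightarrow> 'a set \<Rightarrow> 'a set \<Rightarrow> bool" where
  "double_lattice X1 X2 L1 L2 \<longleftrightarrow>
     polytope X1 \<and> polytope X2 \<and> is_lattice L1 \<and> is_lattice L2 \<and>
     (\<forall>X\<in>{X1, X2}. \<forall>L\<in>{L1, L2}. fundamental_domain L X)"

text \<open>Translation of a point of \<open>X\<close> into \<open>Y\<close> by a vector of \<open>L\<close>, where that vector is unique.\<close>

definition lattice_shift :: "'a::euclidean_space set \<Rightarrow> 'a set \<Rightarrow> 'a set \<Rightarrow> 'a \<rightharpoonup> 'a" where
  "lattice_shift L X Y p =
     (if p \<in> X \<and> (\<exists>!l. l \<in> L \<and> p + l \<in> Y)
      then Some (p + (THE l. l \<in> L \<and> p + l \<in> Y)) else None)"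

definition double_lattice_PET ::
    "'a::euclidean_space set \<Rightarrow> 'a set \<Rightarrow> 'a set \<Rightarrow> 'a set \<Rightarrow> 'a \<rightharpoonup> 'a" where
  "double_lattice_PET X1 X2 L1 L2 = lattice_shift L1 X2 X1 \<circ>\<^sub>m lattice_shift L2 X1 X2"

text \<open>
  A finite polytope partition of the torus is given by lifts of its pieces to \<open>\<complex>\<^sup>2\<close>;
  the pieces overlap only in boundaries.
\<close>

definition torus_partition :: "(complex \<times> complex) set set \<Rightarrow> bool" where
  "torus_partition PP \<longleftrightarrow>
     finite PP \<and> (\<forall>P\<in>PP. polytope P \<and> interior P \<noteq> {}) \<and>
     (\<forall>P\<in>PP. \<forall>P'\<in>PP. P \<noteq> P' \<longrightarrow> interior P \<inter> interior P' = {}) \<and>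
     fundamental_domain gauss2 (\<Union>PP)"

definition open_pieces :: "(complex \<times> complex) set set \<Rightarrow> torus4 set" where
  "open_pieces PP = (\<Union>P\<in>PP. torus ` interior P)"

definition repeating_coords :: "(complex \<times> complex \<Rightarrow> complex ^ 'n) \<Rightarrow> bool" where
  "repeating_coords E \<longleftrightarrow>
     linear E \<and> inj E \<and> (\<forall>j. (\<forall>w. E w $ j = fst w) \<or> (\<forall>w. E w $ j = snd w))"

definition piecewise_translation ::
    "(complex \<times> complex) set set \<Rightarrow> (torus4 \<Rightarrow> complex ^ 'n) \<Rightarrow> bool" where
  "piecewise_translation PP \<phi> \<longleftrightarrow>
     torus_partition PP \<and>
     (\<exists>E. repeating_coords E \<and> (\<forall>P\<in>PP. \<exists>v. \<forall>w\<in>interior P. \<phi> (torus w) = E w + v))"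

definition invariant_under :: "('a \<rightharpoonup> 'a) \<Rightarrow> 'a set \<Rightarrow> bool" where
  "invariant_under f Y \<longleftrightarrow> ran (f |` Y) \<subseteq> Y"

text \<open>
  \<open>\<phi>\<close> is only considered on \<open>open_pieces PP\<close>, whose image has to be all of \<open>Y\<close> up to
  boundaries.  The last two clauses say that the conjugacy equation holds
  wherever both sides are defined, and that both sides are defined at almost every point of
  the torus.  The latter does not follow from \<open>f\<close> being defined almost everywhere on its
  polytope, because \<open>Y\<close> may be a null set there.
\<close>

definition conjugates ::
    "(complex \<times> complex) set set \<Rightarrow> (torus4 \<Rightarrow> complex ^ 'n) \<Rightarrow>
     (torus4 \<rightharpoonup> torus4) \<Rightarrow> (complex ^ 'n \<rightharpoonup> complex ^ 'n) \<Rightarrow> (complex ^ 'n) set \<Rightarrow> bool" where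
  "conjugates PP \<phi> F f Y \<longleftrightarrow>
     inj_on \<phi> (open_pieces PP) \<and>
     closure (\<phi> ` open_pieces PP) = Y \<and>
     (\<forall>p\<in>open_pieces PP. \<forall>q\<in>open_pieces PP.
        F p = Some q \<and> \<phi> p \<in> dom f \<longrightarrow> f (\<phi> p) = Some (\<phi> q)) \<and>
     (AE w in lborel. torus w \<in> open_pieces PP \<and>
        (\<exists>q\<in>open_pieces PP. F (torus w) = Some q) \<and> \<phi> (torus w) \<in> dom f)"

end

theory Submission
  imports Defs
begin

text \<open>
  Let \<open>n = 4m + 2\<close>, let \<open>c k\<close> be the \<open>k\<close>-th letter of \<open>h\<close> that acts, and let \<open>x k\<close> be the
  representative in the unit square of the coordinate turned at time \<open>k\<close>.  The turn adds
  \<open>(\<i> - 1) * x k * (d k / d j)\<close> to every coordinate of type \<open>c j\<close>, modulo Gaussian integers,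
  where \<open>d\<close> is the side length \<open>1\<close> or \<open>s\<close>.  Hence \<open>x\<close> is determined by \<open>P x = E w - e\<close> with
  \<open>E w\<close> the coordinates \<open>w1, w2\<close> repeated according to \<open>c\<close>, \<open>e\<close> a Gaussian vector, and \<open>P\<close>
  unipotent triangular; the conjugacy is \<open>w \<mapsto> E w - e\<close>.  The first half of \<open>h\<^sup>2\<close> takes
  \<open>E w - e\<close> to \<open>N (E w - e) + e\<close> for a linear map \<open>N\<close> that differs from the identity by a map of
  rank one into the range of \<open>E\<close>.  Since \<open>\<i> ^ n = -1\<close>, \<open>N\<close> is an involution, and \<open>N \<circ> P\<close> is
  triangular in the opposite order.  So with \<open>C\<close> the unit cube, \<open>X1 = P C\<close>, \<open>X2 = N X1\<close>,
  \<open>L1\<close> the Gaussian vectors and \<open>L2 = N L1\<close> form a double lattice datum.  If \<open>b\<close>, \<open>b'\<close>, \<open>b''\<close>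
  are the images of \<open>w\<close>, \<open>h w\<close>, \<open>h\<^sup>2 w\<close>, then \<open>N b' - b \<in> L2\<close> and \<open>b'' - N b' \<in> L1\<close>, so the
  PET is \<open>b \<mapsto> N b' \<mapsto> b''\<close>.
\<close>

section \<open>Fundamental domains and lattices\<close>

text \<open>Convexity puts \<open>p + l\<close> in the closure of \<open>interior X\<close>, so its
  open neighbourhood \<open>l + interior X\<close> meets \<open>interior X\<close>, although
  distinct translates have disjoint interiors.\<close>

lemma fundamental_domain_interior_unique:
  fixes X :: "'a::euclidean_space set"
  assumes fd: "fundamental_domain L X" and "convex X" "closed X" "0 \<in> L" "l \<in> L"
    and p: "p \<in> interior X" and pl: "p + l \<in> X"
  shows "l = 0"
proof (rule ccontr)
  assume "l \<noteq> 0"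
  then have disj: "interior ((+) l ` X) \<inter> interior ((+) 0 ` X) = {}"
    using fd assms(4,5) unfolding fundamental_domain_def by blast
  have "p + l \<in> closure (interior X)"
    using convex_closure_interior[OF \<open>convex X\<close>] p pl \<open>closed X\<close> by auto
  moreover have "open ((+) l ` interior X)" "p + l \<in> (+) l ` interior X"
    using p by (auto intro: open_translation)
  ultimately have "(+) l ` interior X \<inter> interior X \<noteq> {}"
    by (meson disjoint_iff open_Int_closure_eq_empty)
  then show False
    using disj unfolding interior_translation by simp
qed

text \<open>The translates of the compact \<open>X\<close> by the closed set \<open>L - {0}\<close>
  form a closed set; its complement is open, lies in \<open>X\<close> and contains
  \<open>p\<close>.\<close>

lemma fundamental_domain_unique_imp_interior:
  fixes X :: "'a::euclidean_space set"
  assumes fd: "fundamental_domain L X" and "compact X" "closed (L - {0})"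
    and p: "\<And>l. l \<in> L \<Longrightarrow> p - l \<in> X \<Longrightarrow> l = 0"
  shows "p \<in> interior X"
proof -
  define U where "U = (\<Union>l\<in>L - {0}. \<Union>x\<in>X. {l + x})"
  have "closed U"
    unfolding U_def by (rule closed_compact_sums) fact+
  then have "open (- U)" by (rule open_Compl)
  moreover have "- U \<subseteq> X"
  proof
    fix q assume "q \<in> - U"
    moreover obtain l x where "l \<in> L" "x \<in> X" "q = l + x"
      using fd unfolding fundamental_domain_def by blast
    ultimately show "q \<in> X"
      by (cases "l = 0") (auto simp: U_def)
  qed
  moreover have "p \<in> - U"
    using p unfolding U_def by (auto simp: algebra_simps)
  ultimately show ?thesis by (meson interior_maximal subsetD)
qed

lemma fundamental_domain_linear_image:
  fixes X :: "'a::euclidean_space set" and f :: "'a \<Rightarrow> 'a"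
  assumes fd: "fundamental_domain L X" and f: "linear f" "inj f"
  shows "fundamental_domain (f ` L) (f ` X)"
proof -
  have im: "(+) (f l) ` f ` X = f ` (+) l ` X" for l
    by (auto simp: image_image linear_add[OF f(1)])
  have int: "interior (f ` A) = f ` interior A" for A
    using f by (rule interior_injective_linear_image)
  have "surj f"
    using f by (rule linear_inj_imp_surj)
  have "(\<Union>l\<in>f ` L. (+) l ` f ` X) = f ` (\<Union>l\<in>L. (+) l ` X)"
    unfolding image_UN by (simp add: im)
  also have "\<dots> = UNIV"
    using fd \<open>surj f\<close> unfolding fundamental_domain_def by simp
  finally show ?thesis
    using fd f(2) unfolding fundamental_domain_def
    by (simp add: im int image_Int[OF f(2), symmetric] inj_eq[OF f(2)])
qed

lemma is_lattice_linear_image: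
  fixes f :: "'a::euclidean_space \<Rightarrow> 'a"
  assumes "is_lattice L" and f: "linear f" "inj f"
  shows "is_lattice (f ` L)"
proof -
  obtain B where B: "independent B" "span B = UNIV"
      "L = {(\<Sum>b\<in>B. of_int (c b) *\<^sub>R b) |c :: 'a \<Rightarrow> int. True}"
    using assms(1) unfolding is_lattice_def by blast
  have inj: "inj_on f B"
    using f(2) by (rule inj_on_subset) simp
  have sum: "(\<Sum>b\<in>f ` B. of_int (c b) *\<^sub>R b) = f (\<Sum>b\<in>B. of_int (c (f b)) *\<^sub>R b)" for c :: "'a \<Rightarrow> int"
    by (simp add: sum.reindex[OF inj] linear_sum[OF f(1)] linear_scale[OF f(1)])
  have "f ` L = {(\<Sum>b\<in>f ` B. of_int (c b) *\<^sub>R b) |c :: 'a \<Rightarrow> int. True}"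
  proof (intro equalityI subsetI)
    fix y assume "y \<in> f ` L"
    then obtain c :: "'a \<Rightarrow> int" where "y = f (\<Sum>b\<in>B. of_int (c b) *\<^sub>R b)"
      using B(3) by auto
    then have "y = (\<Sum>b\<in>f ` B. of_int ((c \<circ> inv_into UNIV f) b) *\<^sub>R b)"
      unfolding sum by (simp add: f(2))
    then show "y \<in> {(\<Sum>b\<in>f ` B. of_int (c b) *\<^sub>R b) |c :: 'a \<Rightarrow> int. True}"
      by blast
  next
    fix y assume "y \<in> {(\<Sum>b\<in>f ` B. of_int (c b) *\<^sub>R b) |c :: 'a \<Rightarrow> int. True}"
    then show "y \<in> f ` L"
      unfolding B(3) sum by auto
  qed
  moreover have "independent (f ` B)"
    using linear_independent_injective_image[OF f(1) B(1)] inj_on_subset[OF f(2)] by blast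
  moreover have "span (f ` B) = UNIV"
    using linear_inj_imp_surj[OF f] B(2) by (simp add: linear_span_image f(1))
  ultimately show ?thesis
    unfolding is_lattice_def by (intro exI[of _ "f ` B"] conjI)
qed

section \<open>Null sets of affine maps\<close>

lemma AE_linear_neq:
  fixes l :: "'a::euclidean_space \<Rightarrow> real"
  assumes l: "linear l" and "l a \<noteq> 0"
  shows "AE x in lborel. l x \<noteq> t"
proof -
  define c where "c = adjoint l 1"
  have c: "c \<bullet> x = l x" for x
    using adjoint_works[OF l, of x 1] unfolding c_def by (simp add: inner_commute)
  then have "c \<noteq> 0"
    using assms(2) by (metis inner_zero_left)
  then have "negligible {x. c \<bullet> x = t}"
    by (intro negligible_hyperplane) simp
  then have "negligible {x. l x = t}"
    unfolding c .
  then have "AE x in lebesgue. x \<notin> {x. l x = t}"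
    unfolding negligible_iff_null_sets by (rule AE_not_in)
  then show ?thesis
    by (simp add: AE_completion_iff)
qed

text \<open>\<open>A\<close> is its own inverse, so the exceptional set lies in the image under
  \<open>A\<close> of a translated null set, which is null because \<open>A\<close> is
  differentiable.\<close>

lemma AE_affine:
  fixes A :: "'a::euclidean_space \<Rightarrow> 'a"
  assumes R: "AE x in lborel. R x" and A: "linear A" and AA: "\<And>x. A (A x) = x"
  shows "AE x in lborel. R (A x + v)"
proof -
  have "AE x in lebesgue. R x"
    using R by (rule AE_completion)
  then obtain Z where Z: "Z \<in> null_sets lebesgue" "{x \<in> space lebesgue. \<not> R x} \<subseteq> Z"
    unfolding eventually_ae_filter by auto
  then have "negligible ((+) (- v) ` Z)"
    using negligible_translation[of Z "- v"] by (simp only: negligible_iff_null_sets)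
  then have neg: "negligible (A ` (+) (- v) ` Z)"
    by (rule negligible_differentiable_image_negligible[OF order_refl])
      (simp add: A linear_imp_differentiable_on)
  have "x \<in> A ` (+) (- v) ` Z" if "\<not> R (A x + v)" for x
    using that Z(2) by (intro image_eqI[of _ _ "A x"] image_eqI[of _ _ "A x + v"]) (auto simp: AA)
  then have "AE x in lebesgue. R (A x + v)"
    using neg unfolding negligible_iff_null_sets by (auto intro: AE_I')
  then show ?thesis
    by (simp add: AE_completion_iff)
qed

lemma AE_lborel_imp_dense:
  fixes R :: "'a::euclidean_space \<Rightarrow> bool"
  assumes "AE x in lborel. R x"
  shows "closure {x. R x} = UNIV"
proof (rule ccontr)
  assume "closure {x. R x} \<noteq> UNIV"
  then have ne: "- closure {x. R x} \<noteq> {}" by auto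
  have "AE x in lebesgue. R x"
    using assms by (rule AE_completion)
  then obtain Z where Z: "Z \<in> null_sets lebesgue" "{x \<in> space lebesgue. \<not> R x} \<subseteq> Z"
    unfolding eventually_ae_filter by auto
  have "- closure {x. R x} \<subseteq> Z"
    using Z(2) closure_subset[of "{x. R x}"] by auto
  then have "negligible (- closure {x. R x})"
    using Z(1) negligible_iff_null_sets negligible_subset by blast
  then show False
    using open_not_negligible[of "- closure {x. R x}"] ne by auto
qed

section \<open>Gaussian vectors and the unit cube\<close>

definition gauss_lattice :: "(complex ^ 'n) set" where
  "gauss_lattice = {l. \<forall>k. Re (l $ k) \<in> \<int> \<and> Im (l $ k) \<in> \<int>}"

definition unit_cube :: "(complex ^ 'n) set" where
  "unit_cube = {x. \<forall>k. \<bar>Re (x $ k)\<bar> \<le> 1/2 \<and> \<bar>Im (x $ k)\<bar> \<le> 1/2}"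

lemma gauss_lattice_simps [simp]:
  shows "0 \<in> gauss_lattice"
    and "x \<in> gauss_lattice \<Longrightarrow> y \<in> gauss_lattice \<Longrightarrow> x + y \<in> gauss_lattice"
    and "x \<in> gauss_lattice \<Longrightarrow> y \<in> gauss_lattice \<Longrightarrow> x - y \<in> gauss_lattice"
  by (auto simp: gauss_lattice_def)

lemma gauss_lattice_dist:
  assumes "x \<in> gauss_lattice" "y \<in> gauss_lattice" "dist y x < 1"
  shows "y = x"
proof -
  have "y $ k = x $ k" for k
  proof -
    have "cmod ((y - x) $ k) \<le> dist y x"
      unfolding dist_norm by (rule Finite_Cartesian_Product.norm_nth_le)
    then have "\<bar>Re ((y - x) $ k)\<bar> < 1" "\<bar>Im ((y - x) $ k)\<bar> < 1"
      using assms(3) abs_Re_le_cmod abs_Im_le_cmod by (meson le_less_trans order_trans)+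
    moreover have "y - x \<in> gauss_lattice"
      using assms by simp
    ultimately have "Re ((y - x) $ k) = 0" "Im ((y - x) $ k) = 0"
      unfolding gauss_lattice_def
      using Ints_eq_abs_less1[OF _ Ints_0, of "Re ((y - x) $ k)"]
        Ints_eq_abs_less1[OF _ Ints_0, of "Im ((y - x) $ k)"] by auto
    then show ?thesis by (simp add: complex_eq_iff)
  qed
  then show ?thesis by (simp add: vec_eq_iff)
qed

lemma closed_subset_gauss_lattice:
  fixes A :: "(complex ^ 'n::finite) set"
  assumes "A \<subseteq> gauss_lattice"
  shows "closed A"
  using assms gauss_lattice_dist by (intro discrete_imp_closed[of 1]) (auto simp: subset_iff)

lemma finite_gauss_lattice_bounded:
  fixes S :: "(complex ^ 'n::finite) set"
  assumes "bounded S"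
  shows "finite (gauss_lattice \<inter> S)"
proof -
  have "\<not> z islimpt gauss_lattice" for z :: "complex ^ 'n"
    by (rule discrete_imp_not_islimpt[of 1]) (auto simp: gauss_lattice_dist)
  then have "finite (closure S \<inter> gauss_lattice)"
    using assms by (intro finite_not_islimpt_in_compact) auto
  then show ?thesis
    by (rule finite_subset[rotated]) (use closure_subset in auto)
qed

lemma countable_gauss_lattice: "countable (gauss_lattice :: (complex ^ 'n::finite) set)"
proof -
  have "gauss_lattice \<subseteq> (\<Union>N::nat. gauss_lattice \<inter> cball (0 :: complex ^ 'n) (real N))"
  proof
    fix x :: "complex ^ 'n" assume "x \<in> gauss_lattice"
    moreover obtain N :: nat where "norm x \<le> real N"
      using real_arch_simple by blast
    ultimately show "x \<in> (\<Union>N::nat. gauss_lattice \<inter> cball 0 (real N))" by auto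
  qed
  moreover have "countable (gauss_lattice \<inter> cball (0 :: complex ^ 'n) (real N))" for N :: nat
    by (intro countable_finite finite_gauss_lattice_bounded bounded_cball)
  ultimately show ?thesis
    by (meson countable_UN countable_subset uncountable_def countableI_type)
qed

lemma is_lattice_gauss_lattice: "is_lattice (gauss_lattice :: (complex ^ 'n::finite) set)"
proof -
  have "gauss_lattice = {(\<Sum>b\<in>Basis. of_int (c b) *\<^sub>R b) |c :: complex ^ 'n \<Rightarrow> int. True}"
    (is "_ = ?R")
  proof (intro equalityI subsetI)
    fix x :: "complex ^ 'n" assume x: "x \<in> gauss_lattice"
    have "x \<bullet> b \<in> \<int>" if "b \<in> Basis" for b
      using that x by (auto simp: Basis_vec_def Basis_complex_def inner_axis gauss_lattice_def)
    then have "(\<Sum>b\<in>Basis. of_int \<lfloor>x \<bullet> b\<rfloor> *\<^sub>R b) = (\<Sum>b\<in>Basis. (x \<bullet> b) *\<^sub>R b)"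
      by (intro sum.cong) simp_all
    then have "x = (\<Sum>b\<in>Basis. of_int ((\<lambda>b. \<lfloor>x \<bullet> b\<rfloor>) b) *\<^sub>R b)"
      by (simp only: euclidean_representation)
    then show "x \<in> ?R"
      by (intro CollectI exI conjI TrueI)
  next
    fix x assume "x \<in> ?R"
    then obtain c :: "complex ^ 'n \<Rightarrow> int" where c: "x = (\<Sum>b\<in>Basis. of_int (c b) *\<^sub>R b)" by blast
    then have *: "x \<bullet> b = of_int (c b)" if "b \<in> Basis" for b
      using that by simp
    have "x \<bullet> axis k 1 \<in> \<int>" "x \<bullet> axis k \<i> \<in> \<int>" for k
      using *[of "axis k 1"] *[of "axis k \<i>"] by (simp_all add: axis_in_Basis_iff Basis_complex_def)
    then show "x \<in> gauss_lattice"
      by (simp add: gauss_lattice_def inner_axis)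
  qed
  then show ?thesis
    unfolding is_lattice_def by (intro exI[of _ Basis] conjI independent_Basis span_Basis)
qed

lemma unit_cube_eq_cbox: "unit_cube = cbox (\<chi> k. Complex (-1/2) (-1/2)) (\<chi> k. Complex (1/2) (1/2))"
proof -
  have *: "\<bar>x\<bar> \<le> 1/2 \<longleftrightarrow> - 1/2 \<le> x \<and> x \<le> 1/2" for x :: real by linarith
  show ?thesis
    unfolding unit_cube_def *
    by (auto simp: mem_box Basis_vec_def Basis_complex_def inner_axis)
qed

lemma interior_unit_cube:
  "interior unit_cube = {x :: complex ^ 'n::finite. \<forall>k. x $ k \<in> open_square}"
proof -
  have *: "\<bar>x\<bar> < 1/2 \<longleftrightarrow> - 1/2 < x \<and> x < 1/2" for x :: real by linarith
  show ?thesis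
    unfolding unit_cube_eq_cbox interior_cbox open_square_def mem_Collect_eq *
    by (auto simp: mem_box Basis_vec_def Basis_complex_def inner_axis)
qed

section \<open>Triangular maps modulo Gaussian vectors\<close>

lemma gauss_residue_exists:
  assumes "a = 1 \<or> a = \<i>"
  obtains y where "\<bar>Re y\<bar> \<le> 1/2" "\<bar>Im y\<bar> \<le> 1/2" "Re (z - a * y) \<in> \<int>" "Im (z - a * y) \<in> \<int>"
proof -
  define y where "y = z - Complex (of_int (round (Re z))) (of_int (round (Im z)))"
  have y: "\<bar>Re y\<bar> \<le> 1/2" "\<bar>Im y\<bar> \<le> 1/2" "Re (z - y) \<in> \<int>" "Im (z - y) \<in> \<int>"
    using of_int_round_abs_le[of "Re z"] of_int_round_abs_le[of "Im z"]
    by (auto simp: y_def abs_minus_commute)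
  show ?thesis
  proof (cases "a = 1")
    case True
    then show ?thesis using y that[of y] by simp
  next
    case False
    then show ?thesis using assms y that[of "- \<i> * y"] by simp
  qed
qed

text \<open>\<open>r\<close> ranks the coordinates. Once lower ranks agree, row \<open>k\<close> of
  \<open>T x - T y\<close> is the unit \<open>a\<close> times a difference of two points of the open
  square; that difference is then Gaussian, hence zero.\<close>

lemma triangular_unique:
  fixes T :: "complex ^ 'n::finite \<Rightarrow> complex ^ 'n" and r :: "'n \<Rightarrow> nat"
  assumes a: "a = 1 \<or> a = \<i>"
    and T: "\<And>x k. T x $ k = a * x $ k + (\<Sum>j | r j < r k. M k j * x $ j)"
    and x: "x \<in> interior unit_cube" and y: "y \<in> interior unit_cube"
    and xy: "T x - T y \<in> gauss_lattice"
  shows "x = y"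
proof -
  have "x $ k = y $ k" for k
  proof (induction k rule: measure_induct_rule[of r])
    case (less k)
    then have "(T x - T y) $ k = a * (x $ k - y $ k)"
      by (simp add: T algebra_simps)
    moreover have "Re ((T x - T y) $ k) \<in> \<int>" "Im ((T x - T y) $ k) \<in> \<int>"
      using xy unfolding gauss_lattice_def by auto
    moreover have "Re d \<in> \<int> \<and> Im d \<in> \<int>" if "Re (a * d) \<in> \<int>" "Im (a * d) \<in> \<int>" for d
      using a that by auto
    ultimately have "Re (x $ k - y $ k) \<in> \<int>" "Im (x $ k - y $ k) \<in> \<int>"
      by metis+
    then show ?case
      using x y unfolding interior_unit_cube by (blast intro: open_square_int_eq)
  qed
  then show ?thesis by (simp add: vec_eq_iff)
qed

lemma triangular_inj:
  fixes T :: "complex ^ 'n::finite \<Rightarrow> complex ^ 'n" and r :: "'n \<Rightarrow> nat"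
  assumes "linear T" and a: "a = 1 \<or> a = \<i>"
    and T: "\<And>x k. T x $ k = a * x $ k + (\<Sum>j | r j < r k. M k j * x $ j)"
  shows "inj T"
  unfolding linear_injective_0[OF \<open>linear T\<close>]
proof (intro allI impI)
  fix x assume x: "T x = 0"
  have "x $ k = 0" for k
  proof (induction k rule: measure_induct_rule[of r])
    case (less k)
    then have "T x $ k = a * x $ k" by (simp add: T)
    then show ?case using x a by auto
  qed
  then show "x = 0" by (simp add: vec_eq_iff)
qed

lemma triangular_cover:
  fixes T :: "complex ^ 'n::finite \<Rightarrow> complex ^ 'n" and r :: "'n \<Rightarrow> nat"
  assumes a: "a = 1 \<or> a = \<i>"
    and T: "\<And>x k. T x $ k = a * x $ k + (\<Sum>j | r j < r k. M k j * x $ j)"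
  shows "\<exists>x\<in>unit_cube. b - T x \<in> gauss_lattice"
proof -
  have "\<exists>x\<in>unit_cube. \<forall>k. r k < m \<longrightarrow> Re ((b - T x) $ k) \<in> \<int> \<and> Im ((b - T x) $ k) \<in> \<int>" for m
  proof (induction m)
    case 0
    show ?case by (intro bexI[of _ 0]) (auto simp: unit_cube_def)
  next
    case (Suc m)
    then obtain x where x: "x \<in> unit_cube"
      and *: "\<And>k. r k < m \<Longrightarrow> Re ((b - T x) $ k) \<in> \<int> \<and> Im ((b - T x) $ k) \<in> \<int>" by blast
    define z where "z k = b $ k - (\<Sum>j | r j < r k. M k j * x $ j)" for k
    have "\<exists>y. \<bar>Re y\<bar> \<le> 1/2 \<and> \<bar>Im y\<bar> \<le> 1/2 \<and>
        Re (z k - a * y) \<in> \<int> \<and> Im (z k - a * y) \<in> \<int>" for k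
      by (rule gauss_residue_exists[OF a, of "z k"]) blast
    then obtain y where y: "\<And>k. \<bar>Re (y k)\<bar> \<le> 1/2 \<and> \<bar>Im (y k)\<bar> \<le> 1/2 \<and>
        Re (z k - a * y k) \<in> \<int> \<and> Im (z k - a * y k) \<in> \<int>" by metis
    \<comment> \<open>Changing the coordinates of rank \<open>m\<close> does not affect the sums in
      rows of rank at most \<open>m\<close>.\<close>
    define x' where "x' = (\<chi> k. if r k = m then y k else x $ k)"
    have "x' \<in> unit_cube"
      using x y by (auto simp: unit_cube_def x'_def)
    moreover have "Re ((b - T x') $ k) \<in> \<int> \<and> Im ((b - T x') $ k) \<in> \<int>" if "r k < Suc m" for k
    proof -
      have sum: "(\<Sum>j | r j < r k. M k j * x' $ j) = (\<Sum>j | r j < r k. M k j * x $ j)"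
        using that by (intro sum.cong) (auto simp: x'_def)
      show ?thesis
      proof (cases "r k = m")
        case True
        then have "(b - T x') $ k = z k - a * y k"
          by (simp only: vector_minus_component T sum z_def) (simp add: x'_def)
        then show ?thesis using y by (simp only:)
      next
        case False
        then have "(b - T x') $ k = (b - T x) $ k"
          by (simp only: vector_minus_component T sum) (simp add: x'_def)
        moreover have "r k < m" using False that by simp
        ultimately show ?thesis using * by (simp only:)
      qed
    qed
    ultimately show ?case by blast
  qed
  moreover obtain m where "\<forall>k. r k < m"
    using finite_nat_set_iff_bounded[of "range r"] by auto
  ultimately show ?thesis
    unfolding gauss_lattice_def by blast
qed

text \<open>Solvability in the closed cube gives the cover, uniqueness in the open cube the disjoint
  interiors. The case \<open>a = 1\<close> serves for \<open>P\<close>, the case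
  \<open>a = \<i>\<close> with reversed ranking for \<open>N \<circ> P\<close>.\<close>

lemma triangular_fundamental_domain:
  fixes T :: "complex ^ 'n::finite \<Rightarrow> complex ^ 'n" and r :: "'n \<Rightarrow> nat"
  assumes lin: "linear T" and a: "a = 1 \<or> a = \<i>"
    and T: "\<And>x k. T x $ k = a * x $ k + (\<Sum>j | r j < r k. M k j * x $ j)"
  shows "fundamental_domain gauss_lattice (T ` unit_cube)"
  unfolding fundamental_domain_def
proof (intro conjI ballI impI)
  show "(\<Union>l\<in>gauss_lattice. (+) l ` T ` unit_cube) = UNIV"
  proof (intro equalityI subsetI UNIV_I)
    fix b
    obtain x where "x \<in> unit_cube" "b - T x \<in> gauss_lattice"
      using triangular_cover[where T = T, OF a T] by blast
    then show "b \<in> (\<Union>l\<in>gauss_lattice. (+) l ` T ` unit_cube)"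
      by (intro UN_I[of "b - T x"] image_eqI[of b _ "T x"] imageI) auto
  qed
next
  fix l l' :: "complex ^ 'n" assume l: "l \<in> gauss_lattice" "l' \<in> gauss_lattice" "l \<noteq> l'"
  have "inj T"
    by (rule triangular_inj[where T = T, OF lin a T])
  have int: "interior ((+) v ` T ` unit_cube) = (+) v ` T ` interior unit_cube" for v
    by (simp add: interior_translation interior_injective_linear_image lin \<open>inj T\<close>)
  show "interior ((+) l ` T ` unit_cube) \<inter> interior ((+) l' ` T ` unit_cube) = {}"
  proof (rule ccontr)
    assume "interior ((+) l ` T ` unit_cube) \<inter> interior ((+) l' ` T ` unit_cube) \<noteq> {}"
    then obtain x y where xy: "x \<in> interior unit_cube" "y \<in> interior unit_cube" "l + T x = l' + T y"
      unfolding int by blast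
    then have "T x - T y = l' - l" by (simp add: algebra_simps)
    then have "x = y"
      using l xy by (intro triangular_unique[where T = T, OF a T]) auto
    then show False using xy(3) l(3) by simp
  qed
qed

section \<open>Lattice shifts and interior points\<close>

lemma lattice_shift_SomeD:
  fixes Y :: "'a::euclidean_space set"
  assumes fd: "fundamental_domain L Y" and "compact Y" "closed (L - {0})"
    and diff: "\<And>x y. x \<in> L \<Longrightarrow> y \<in> L \<Longrightarrow> x - y \<in> L"
    and p: "lattice_shift L X Y p = Some q"
  shows "p \<in> X" "q - p \<in> L" "q \<in> interior Y"
proof -
  have ex1: "\<exists>!l. l \<in> L \<and> p + l \<in> Y" and "p \<in> X"
    using p unfolding lattice_shift_def by (auto split: if_splits)
  then show "p \<in> X" by simp
  have q: "q = p + (THE l. l \<in> L \<and> p + l \<in> Y)"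
    using p unfolding lattice_shift_def by (auto split: if_splits)
  then show l: "q - p \<in> L"
    using theI'[OF ex1] by simp
  have qY: "q \<in> Y"
    using theI'[OF ex1] q by simp
  show "q \<in> interior Y"
  \<comment> \<open>If \<open>q - l\<close> were also in \<open>Y\<close>, then
    \<open>q - p - l\<close> would be a second admissible vector; so \<open>q\<close> lies in no
    other translate of \<open>Y\<close>.\<close>
  proof (rule fundamental_domain_unique_imp_interior[OF fd])
    fix l assume "l \<in> L" "q - l \<in> Y"
    then have "q - p - l \<in> L \<and> p + (q - p - l) \<in> Y"
      using diff l by simp
    moreover have "q - p \<in> L \<and> p + (q - p) \<in> Y"
      using l qY by simp
    ultimately have "q - p - l = q - p"
      using ex1 by blast
    then show "l = 0" by simp
  qed fact+
qed

lemma lattice_shift_SomeI: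
  fixes Y :: "'a::euclidean_space set"
  assumes fd: "fundamental_domain L Y" and "convex Y" "closed Y"
    and diff: "\<And>x y. x \<in> L \<Longrightarrow> y \<in> L \<Longrightarrow> x - y \<in> L"
    and p: "p \<in> X" "q - p \<in> L" "q \<in> interior Y"
  shows "lattice_shift L X Y p = Some q"
proof -
  have 0: "0 \<in> L" using diff[OF p(2) p(2)] by simp
  have *: "l = q - p" if "l \<in> L \<and> p + l \<in> Y" for l
  proof -
    have "l - (q - p) = 0"
      using that p diff
      by (intro fundamental_domain_interior_unique[OF fd assms(2,3) 0 _ p(3)]) (auto simp: add.commute)
    then show ?thesis by simp
  qed
  have ex: "q - p \<in> L \<and> p + (q - p) \<in> Y"
    using p interior_subset by auto
  have "\<exists>!l. l \<in> L \<and> p + l \<in> Y"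
    using * ex by blast
  moreover have "(THE l. l \<in> L \<and> p + l \<in> Y) = q - p"
    using * ex by (intro the_equality) auto
  ultimately show ?thesis
    using p(1) unfolding lattice_shift_def by simp
qed

definition coords :: "('n \<Rightarrow> gen) \<Rightarrow> complex \<times> complex \<Rightarrow> complex ^ 'n" where
  "coords c w = (\<chi> k. turned_coord (c k) w)"

lemma coords_nth [simp]: "coords c w $ k = turned_coord (c k) w"
  by (simp add: coords_def)

lemma turned_coord_simps [simp]:
  shows "turned_coord a (w + w') = turned_coord a w + turned_coord a w'"
    and "turned_coord a (w - w') = turned_coord a w - turned_coord a w'"
    and "turned_coord a (t *\<^sub>R w) = t *\<^sub>R turned_coord a w"
    and "turned_coord a 0 = 0"
  by (cases a; simp)+

lemma linear_coords: "linear (coords c)"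
  by (intro linearI) (simp_all add: vec_eq_iff)

section \<open>The double lattice PET of a triangular coordinate change\<close>

lemma mem_image_iff_inverse:
  assumes "\<And>x. g (h x) = x" "\<And>y. h (g y) = y"
  shows "y \<in> h ` S \<longleftrightarrow> g y \<in> S"
proof
  assume "g y \<in> S"
  then show "y \<in> h ` S"
    using assms(2)[of y] by (intro image_eqI[of _ _ "g y"]) simp_all
qed (use assms(1) in auto)

text \<open>
  \<open>V = P\<^sup>-\<^sup>1\<close> reads off the turned coordinates, \<open>\<nu>\<close> is the displacement of the lift under the word
  \<open>hw\<close>, and the genericity assumptions make the boundary of every piece a null set.
\<close>

locale turning_PET =
  fixes s :: real and c :: "'n::finite \<Rightarrow> gen" and j1 j2 :: 'n
    and P V :: "complex ^ 'n \<Rightarrow> complex ^ 'n"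
    and \<nu> :: "complex ^ 'n \<Rightarrow> complex \<times> complex"
    and hw :: "gen list"
  assumes c: "c j1 = A1" "c j2 = A2"
    and linear_P: "linear P" and linear_V: "linear V" and linear_\<nu>: "linear \<nu>"
    and VP: "V (P x) = x" and PV: "P (V b) = b"
    and invol: "(b + coords c (\<nu> b)) + coords c (\<nu> (b + coords c (\<nu> b))) = b"
    and fd1: "fundamental_domain gauss_lattice (P ` unit_cube)"
    and fd2: "fundamental_domain gauss_lattice ((\<lambda>b. b + coords c (\<nu> b)) ` P ` unit_cube)"
    and Re_generic: "\<exists>w. Re (V (coords c w) $ k) \<noteq> 0"
    and Im_generic: "\<exists>w. Im (V (coords c w) $ k) \<noteq> 0"
    and word_map_hw: "e \<in> gauss_lattice \<Longrightarrow> \<forall>k. V (coords c w - e) $ k \<in> open_square \<Longrightarrow>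
      word_map s hw (torus w) = Some (torus (w + \<nu> (coords c w - e)))"
begin

abbreviation E :: "complex \<times> complex \<Rightarrow> complex ^ 'n" where
  "E \<equiv> coords c"

definition N :: "complex ^ 'n \<Rightarrow> complex ^ 'n" where
  "N b = b + E (\<nu> b)"

definition X1 :: "(complex ^ 'n) set" where
  "X1 = P ` unit_cube"

definition X2 :: "(complex ^ 'n) set" where
  "X2 = N ` X1"

abbreviation L1 :: "(complex ^ 'n) set" where
  "L1 \<equiv> gauss_lattice"

definition L2 :: "(complex ^ 'n) set" where
  "L2 = N ` L1"

abbreviation f :: "complex ^ 'n \<rightharpoonup> complex ^ 'n" where
  "f \<equiv> double_lattice_PET X1 X2 L1 L2"

definition retract :: "complex ^ 'n \<Rightarrow> complex \<times> complex" where
  "retract b = (b $ j1, b $ j2)"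

lemma retract_E [simp]: "retract (E w) = w"
  by (simp add: retract_def c)

lemma linear_retract: "linear retract"
  by (intro linearI) (simp_all add: retract_def)

lemmas E_simps = linear_add[OF linear_coords] linear_diff[OF linear_coords]

lemma inj_E: "inj E"
  by (metis injI retract_E)

lemma E_in_gauss_lattice: "E l \<in> gauss_lattice \<longleftrightarrow> l \<in> gauss2"
proof
  assume "E l \<in> gauss_lattice"
  then have "Re (E l $ k) \<in> \<int> \<and> Im (E l $ k) \<in> \<int>" for k
    by (simp add: gauss_lattice_def)
  from this[of j1] this[of j2] show "l \<in> gauss2"
    by (cases l) (simp add: c gauss2_def)
next
  assume "l \<in> gauss2"
  then have "Re (turned_coord a l) \<in> \<int> \<and> Im (turned_coord a l) \<in> \<int>" for a
    by (cases a; cases l) (auto simp: gauss2_def)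
  then show "E l \<in> gauss_lattice"
    by (simp add: gauss_lattice_def)
qed

section \<open>The double lattice datum\<close>

lemma linear_N: "linear N"
proof -
  have "linear (\<lambda>b. b + (E \<circ> \<nu>) b)"
    by (intro linear_compose_add linear_ident linear_compose linear_\<nu> linear_coords)
  then show ?thesis by (simp add: N_def[abs_def])
qed

lemma NN [simp]: "N (N b) = b"
  using invol by (simp add: N_def)

lemma inj_N: "inj N"
  by (metis injI NN)

lemma fd_X1_L1: "fundamental_domain L1 X1"
  using fd1 by (simp add: X1_def)

lemma fd_X2_L1: "fundamental_domain L1 X2"
  using fd2 by (simp add: X2_def X1_def N_def[abs_def])

lemma fd_X2_L2: "fundamental_domain L2 X2"
  unfolding X2_def L2_def by (intro fundamental_domain_linear_image fd_X1_L1 linear_N inj_N)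

lemma fd_X1_L2: "fundamental_domain L2 X1"
proof -
  have "fundamental_domain (N ` L1) (N ` X2)"
    by (intro fundamental_domain_linear_image fd_X2_L1 linear_N inj_N)
  then show ?thesis by (simp add: L2_def X2_def image_image)
qed

lemma polytope_X1: "polytope X1"
  unfolding X1_def unit_cube_eq_cbox
  by (intro polytope_linear_image linear_P polytope_interval)

lemma polytope_X2: "polytope X2"
  unfolding X2_def by (intro polytope_linear_image linear_N polytope_X1)

lemmas X1_top = polytope_imp_compact[OF polytope_X1] polytope_imp_convex[OF polytope_X1]
  polytope_imp_closed[OF polytope_X1]
lemmas X2_top = polytope_imp_compact[OF polytope_X2] polytope_imp_convex[OF polytope_X2]
  polytope_imp_closed[OF polytope_X2]

lemma double_lattice_X: "double_lattice X1 X2 L1 L2"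
  unfolding double_lattice_def
  using polytope_X1 polytope_X2 is_lattice_gauss_lattice fd_X1_L1 fd_X1_L2 fd_X2_L1 fd_X2_L2
    is_lattice_linear_image[OF is_lattice_gauss_lattice linear_N inj_N]
  by (auto simp: L2_def)

lemma interior_X1: "b \<in> interior X1 \<longleftrightarrow> (\<forall>k. V b $ k \<in> open_square)"
proof -
  have "inj P" by (metis injI VP)
  then have "interior X1 = P ` interior unit_cube"
    unfolding X1_def by (intro interior_injective_linear_image linear_P)
  moreover have "b \<in> P ` interior unit_cube \<longleftrightarrow> V b \<in> interior unit_cube"
    using VP PV by (rule mem_image_iff_inverse)
  ultimately show ?thesis by (simp add: interior_unit_cube)
qed

lemma interior_X2: "b \<in> interior X2 \<longleftrightarrow> N b \<in> interior X1"
proof -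
  have "interior X2 = N ` interior X1"
    unfolding X2_def by (intro interior_injective_linear_image linear_N inj_N)
  then show ?thesis by (simp add: mem_image_iff_inverse[of N N])
qed

lemma N_L2: "N l \<in> L1 \<longleftrightarrow> l \<in> L2"
  unfolding L2_def by (simp add: mem_image_iff_inverse[of N N])

lemma closed_L1_Diff: "closed (L1 - {0} :: (complex ^ 'n) set)"
  by (rule closed_subset_gauss_lattice) auto

lemma closed_L2_Diff: "closed (L2 - {0})"
proof -
  have "L2 - {0} = N ` (L1 - {0})"
    unfolding L2_def using image_set_diff[OF inj_N] linear_0[OF linear_N] by simp
  then show ?thesis
    using closed_injective_linear_image[OF closed_L1_Diff linear_N inj_N] by simp
qed

lemma L2_diff: "x \<in> L2 \<Longrightarrow> y \<in> L2 \<Longrightarrow> x - y \<in> L2"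
  by (simp add: N_L2[symmetric] linear_diff[OF linear_N])

section \<open>The two shifts in terms of lifts\<close>

lemmas shift_12_SomeD =
  lattice_shift_SomeD[OF fd_X2_L2 X2_top(1) closed_L2_Diff L2_diff, rotated 2]
lemmas shift_12_SomeI =
  lattice_shift_SomeI[OF fd_X2_L2 X2_top(2,3) L2_diff]
lemmas shift_21_SomeD =
  lattice_shift_SomeD[OF fd_X1_L1 X1_top(1) closed_L1_Diff gauss_lattice_simps(3), rotated 2]
lemmas shift_21_SomeI =
  lattice_shift_SomeI[OF fd_X1_L1 X1_top(2,3) gauss_lattice_simps(3)]

text \<open>In the coordinates \<open>E w - e\<close>, moving the lift by \<open>\<nu>\<close> while
  keeping \<open>e\<close> is the map \<open>N\<close>; this links the word to both
  lattices.\<close>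

lemma E_step: "E (w + \<nu> (E w - e)) - e = N (E w - e)"
  by (simp add: N_def E_simps)

text \<open>Expresses through lifts and arbitrary Gaussian \<open>e\<close> that
  \<open>torus w\<close> lies in an open piece (\<open>good_iff\<close>), a form suited to null set
  arguments.\<close>

definition good :: "complex \<times> complex \<Rightarrow> bool" where
  "good w \<longleftrightarrow> (\<exists>e\<in>L1. E w - e \<in> interior X1)"

text \<open>The choice is over all lifts of \<open>p\<close> and all Gaussian \<open>e\<close>; by
  \<open>\<phi>_torus\<close> the value does not depend on it.\<close>

definition \<phi> :: "torus4 \<Rightarrow> complex ^ 'n" where
  "\<phi> p = (SOME b. \<exists>w e. torus w = p \<and> e \<in> L1 \<and> b = E w - e \<and> b \<in> interior X1)"

lemma X1_unique:
  assumes "e \<in> L1" "e' \<in> L1" "E w - e \<in> interior X1" "E w - e' \<in> X1"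
  shows "e = e'"
proof -
  have "e - e' = 0"
    using assms
    by (intro fundamental_domain_interior_unique[OF fd_X1_L1 X1_top(2,3) _ _ assms(3)]) auto
  then show ?thesis by simp
qed

lemma \<phi>_torus:
  assumes "e \<in> L1" "E w - e \<in> interior X1"
  shows "\<phi> (torus w) = E w - e"
  unfolding \<phi>_def
proof (rule some_equality)
  fix b assume "\<exists>w' e. torus w' = torus w \<and> e \<in> L1 \<and> b = E w' - e \<and> b \<in> interior X1"
  then obtain w' e' where *: "w' - w \<in> gauss2" "e' \<in> L1" "b = E w' - e'" "b \<in> interior X1"
    by (auto simp: torus_eq_iff)
  \<comment> \<open>The change of lift is absorbed into the Gaussian vector, so that both values
    belong to the lift \<open>w\<close>.\<close>
  have b: "b = E w - (e' - E (w' - w))"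
    by (simp add: *(3) E_simps)
  have "e = e' - E (w' - w)"
  proof (rule X1_unique[OF assms(1) _ assms(2)])
    show "e' - E (w' - w) \<in> L1"
      using * by (simp add: E_in_gauss_lattice)
    show "E w - (e' - E (w' - w)) \<in> X1"
      using *(4) interior_subset unfolding b by blast
  qed
  then show "b = E w - e" using b by simp
qed (use assms in blast)

lemma shift_12:
  assumes "e \<in> L1" "e' \<in> L1" "E w - e \<in> X1"
    and "E (w + \<nu> (E w - e)) - e' \<in> interior X1"
  shows "lattice_shift L2 X1 X2 (E w - e) = Some (N (E (w + \<nu> (E w - e)) - e'))"
proof (rule shift_12_SomeI)
  \<comment> \<open>Applying \<open>N\<close> turns membership in \<open>L2\<close> into membership
    in \<open>L1\<close>; here it leaves just \<open>e - e'\<close>.\<close>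
  have "N (N b - (E w - e)) = b - (E (w + \<nu> (E w - e)) - e)" for b
    by (simp only: linear_diff[OF linear_N, of "N b"] NN E_step)
  then have "N (N (E (w + \<nu> (E w - e)) - e') - (E w - e)) = e - e'"
    by simp
  then show "N (E (w + \<nu> (E w - e)) - e') - (E w - e) \<in> L2"
    using assms by (simp add: N_L2[symmetric])
qed (use assms in \<open>simp_all add: interior_X2\<close>)

lemma shift_12D:
  assumes e: "e \<in> L1" and "lattice_shift L2 X1 X2 (E w - e) = Some p"
  obtains e' where "e' \<in> L1" "p = N (E (w + \<nu> (E w - e)) - e')"
    "E (w + \<nu> (E w - e)) - e' \<in> interior X1"
proof
  note D = shift_12_SomeD[OF assms(2), simplified]
  \<comment> \<open>Obtained by solving \<open>N (p - (E w - e)) = e - e'\<close> for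
    \<open>e'\<close>.\<close>
  define e' where "e' = e - N (p - (E w - e))"
  have "N p = E (w + \<nu> (E w - e)) - e'"
    unfolding e'_def linear_diff[OF linear_N, of p] E_step[symmetric] by simp
  then show "p = N (E (w + \<nu> (E w - e)) - e')" "E (w + \<nu> (E w - e)) - e' \<in> interior X1"
    using D(3) by (metis NN, simp add: interior_X2)
  show "e' \<in> L1"
    using D(2) e by (simp add: e'_def N_L2)
qed

lemma shift_21:
  assumes "e' \<in> L1" "e'' \<in> L1" "E w' - e' \<in> interior X1"
    and "E (w' + \<nu> (E w' - e')) - e'' \<in> interior X1"
  shows "lattice_shift L1 X2 X1 (N (E w' - e')) = Some (E (w' + \<nu> (E w' - e')) - e'')"
proof (rule shift_21_SomeI)
  have "E (w' + \<nu> (E w' - e')) - e'' - N (E w' - e') = e' - e''"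
    unfolding E_step[symmetric] by simp
  then show "E (w' + \<nu> (E w' - e')) - e'' - N (E w' - e') \<in> L1"
    using assms by (simp only: gauss_lattice_simps)
  show "N (E w' - e') \<in> X2"
    using assms(3) interior_subset unfolding X2_def by blast
qed (use assms in simp_all)

lemma shift_21D:
  assumes e': "e' \<in> L1" and "lattice_shift L1 X2 X1 (N (E w' - e')) = Some q"
  obtains e'' where "e'' \<in> L1" "q = E (w' + \<nu> (E w' - e')) - e''" "q \<in> interior X1"
proof
  note D = shift_21_SomeD[OF assms(2), simplified]
  define e'' where "e'' = e' - (q - N (E w' - e'))"
  show "q = E (w' + \<nu> (E w' - e')) - e''"
    unfolding e''_def E_step[symmetric] by (simp add: algebra_simps)
  show "q \<in> interior X1" by (rule D)
  show "e'' \<in> L1"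
    using D(2) e' by (simp add: e''_def)
qed

lemma word_map_torus:
  assumes "e \<in> L1" "E w - e \<in> interior X1"
  shows "word_map s hw (torus w) = Some (torus (w + \<nu> (E w - e)))"
  using assms by (intro word_map_hw) (simp_all add: interior_X1)

lemma word_map_append: "word_map s (xs @ ys) = word_map s xs \<circ>\<^sub>m word_map s ys"
  by (induction xs) (simp_all add: fun_eq_iff map_comp_def split: option.splits)

text \<open>Affine in \<open>w\<close> for fixed \<open>e\<close>, and defined for every
  \<open>e\<close>; it lifts the word map where \<open>E w - e\<close> is interior to
  \<open>X1\<close>.\<close>

definition step_lift :: "complex ^ 'n \<Rightarrow> complex \<times> complex \<Rightarrow> complex \<times> complex" where
  "step_lift e w = w + \<nu> (E w - e)"

text \<open>\<open>E w - e\<close> may lie on the boundary of \<open>X1\<close>: interiority of the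
  later points comes from definedness of the two shifts.\<close>

lemma PET_SomeD:
  assumes "e \<in> L1" "f (E w - e) = Some q"
  obtains e' e'' where "e' \<in> L1" "e'' \<in> L1" "E (step_lift e w) - e' \<in> interior X1"
    "q \<in> interior X1" "q = E (step_lift e' (step_lift e w)) - e''"
proof -
  obtain p where p: "lattice_shift L2 X1 X2 (E w - e) = Some p" "lattice_shift L1 X2 X1 p = Some q"
    using assms(2) unfolding double_lattice_PET_def by (auto simp: map_comp_Some_iff)
  obtain e' where e': "e' \<in> L1" "p = N (E (step_lift e w) - e')" "E (step_lift e w) - e' \<in> interior X1"
    using shift_12D[OF assms(1) p(1)] unfolding step_lift_def by metis
  obtain e'' where "e'' \<in> L1" "q = E (step_lift e' (step_lift e w)) - e''" "q \<in> interior X1"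
    using shift_21D[OF e'(1) p(2)[unfolded e'(2)]] unfolding step_lift_def by metis
  then show ?thesis using that e' by blast
qed

lemma PET_SomeI:
  assumes "e \<in> L1" "e' \<in> L1" "e'' \<in> L1" "E w - e \<in> interior X1"
    "E (step_lift e w) - e' \<in> interior X1" "E (step_lift e' (step_lift e w)) - e'' \<in> interior X1"
  shows "f (E w - e) = Some (E (step_lift e' (step_lift e w)) - e'')"
proof -
  have "E w - e \<in> X1" using assms(4) interior_subset by blast
  then show ?thesis
    using shift_12[of e e' w] shift_21[of e' e'' "step_lift e w"] assms
    unfolding double_lattice_PET_def by (simp add: step_lift_def)
qed

lemma act_torus:
  assumes "e \<in> L1" "e' \<in> L1" "E w - e \<in> interior X1" "E (step_lift e w) - e' \<in> interior X1"
  shows "act s (of_word (hw @ hw)) (torus w) = Some (torus (step_lift e' (step_lift e w)))"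
  using word_map_torus[OF assms(1,3)] word_map_torus[OF assms(2,4)]
  by (intro act_of_word) (simp add: word_map_append step_lift_def)

text \<open>
  Changing the lift \<open>w\<close> by a Gaussian vector \<open>l\<close> changes \<open>e\<close> by \<open>E l\<close>; requiring that \<open>e\<close> vanish
  at one index of each letter picks one pair \<open>(w, e)\<close> for each point of the torus.
\<close>

definition origins :: "(complex ^ 'n) set" where
  "origins = {e \<in> L1. e $ j1 = 0 \<and> e $ j2 = 0 \<and> (\<exists>w. E w - e \<in> interior X1)}"

definition cell :: "complex ^ 'n \<Rightarrow> (complex \<times> complex) set" where
  "cell e = {w. E w - e \<in> X1}"

definition slice :: "complex ^ 'n \<Rightarrow> (complex ^ 'n) set" where
  "slice e = (\<lambda>w. E w - e) ` cell e"

lemma originsD: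
  assumes "e \<in> origins"
  shows "e \<in> L1" "retract e = 0" "\<exists>w. E w - e \<in> interior X1"
  using assms by (simp_all add: origins_def retract_def zero_prod_def)

lemma normalise_origin:
  assumes "e \<in> L1" "E w - e \<in> interior X1"
  obtains l e0 where "l \<in> gauss2" "e0 \<in> origins" "E (w - l) - e0 = E w - e"
proof
  define l where "l = retract e"
  show l: "l \<in> gauss2"
    using assms(1) by (auto simp: l_def retract_def gauss2_def gauss_lattice_def)
  show eq: "E (w - l) - (e - E l) = E w - e"
    by (simp add: E_simps)
  have "e - E l \<in> L1"
    using assms(1) l by (simp add: E_in_gauss_lattice)
  moreover have "(e - E l) $ j1 = 0" "(e - E l) $ j2 = 0"
    by (simp_all add: l_def retract_def c)
  moreover have "E (w - l) - (e - E l) \<in> interior X1"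
    using assms(2) unfolding eq .
  ultimately show "e - E l \<in> origins"
    unfolding origins_def by blast
qed

section \<open>Cells and slices as polytopes\<close>

lemma polytope_slice: "polytope (slice e)"
proof -
  \<comment> \<open>The slice is \<open>X1\<close> cut by a translate of the range of
    \<open>E\<close>, hence a polytope meeting a polyhedron.\<close>
  have "slice e = X1 \<inter> (+) (- e) ` range E"
    by (auto simp: slice_def cell_def image_iff)
  moreover have "affine ((+) (- e) ` range E)"
    by (intro affine_translation[THEN iffD1] subspace_imp_affine linear_subspace_image
        linear_coords subspace_UNIV)
  ultimately show ?thesis
    by (simp add: polytope_Int_polyhedron polytope_X1 affine_imp_polyhedron)
qed

text \<open>An origin has \<open>retract e = 0\<close>, so \<open>retract\<close> undoes
  \<open>w \<mapsto> E w - e\<close>; the cell is thus a polytope because the slice is.\<close>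

lemma cell_eq_retract_slice:
  assumes "e \<in> origins"
  shows "cell e = retract ` slice e"
proof -
  have "retract (E w - e) = w" for w
    using originsD(2)[OF assms] by (simp add: linear_diff[OF linear_retract])
  then show ?thesis by (simp add: slice_def image_image)
qed

lemma polytope_cell: "e \<in> origins \<Longrightarrow> polytope (cell e)"
  by (simp add: cell_eq_retract_slice polytope_linear_image linear_retract polytope_slice)

text \<open>\<open>E\<close> need not be surjective, so relative interiors are used: they commute
  with the linear preimage of a convex set if the preimage of its relative interior is nonempty,
  which \<open>origins\<close> guarantees.\<close>

lemma interior_cell:
  assumes "e \<in> origins"
  shows "interior (cell e) = {w. E w - e \<in> interior X1}"
proof -
  obtain w where w: "E w - e \<in> interior X1"
    using originsD(3)[OF assms] by blast
  define S where "S = (+) e ` X1"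
  have int_S: "interior S = (+) e ` interior X1"
    unfolding S_def by (rule interior_translation)
  then have rel_S: "rel_interior S = interior S"
    using w by (intro rel_interior_nonempty_interior) auto
  have "convex S"
    unfolding S_def using X1_top(2) by (rule convex_translation)
  have mem: "x - e \<in> A \<longleftrightarrow> x \<in> (+) e ` A" for x and A :: "(complex ^ 'n) set"
    by (auto simp: image_iff algebra_simps) (metis add_diff_cancel_right' diff_add_cancel)
  have cell: "cell e = E -` S"
    by (auto simp: cell_def S_def mem)
  have int: "E -` interior S = {w. E w - e \<in> interior X1}"
    unfolding int_S by (auto simp: mem)
  have ne: "E -` interior S \<noteq> {}"
    using w unfolding int by blast
  have "rel_interior (E -` S) = E -` rel_interior S"
    using ne unfolding rel_S[symmetric]
    by (intro rel_interior_convex_linear_preimage linear_coords \<open>convex S\<close>)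
  moreover have "E -` interior S \<subseteq> interior (E -` S)"
  proof (rule interior_maximal)
    show "E -` interior S \<subseteq> E -` S"
      using interior_subset by blast
    show "open (E -` interior S)"
      by (intro open_vimage open_interior linear_continuous_on linear_coords
          linear_conv_bounded_linear[THEN iffD1])
  qed
  ultimately have "interior (E -` S) = E -` interior S"
    using ne by (metis rel_S rel_interior_nonempty_interior subset_empty)
  then show ?thesis
    unfolding cell int .
qed

lemma interior_cell_nonempty: "e \<in> origins \<Longrightarrow> interior (cell e) \<noteq> {}"
  using originsD(3) by (auto simp: interior_cell)

text \<open>As \<open>retract e = 0\<close>, \<open>e\<close> is recovered from
  \<open>b = E w - e\<close> as \<open>E (retract b) - b\<close>; so the origins are Gaussian
  vectors in a bounded set.\<close>

lemma finite_origins: "finite origins"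
proof -
  have "origins \<subseteq> L1 \<inter> (\<lambda>b. E (retract b) - b) ` X1"
  proof
    fix e assume e: "e \<in> origins"
    then obtain w where "E w - e \<in> interior X1"
      using originsD(3) by blast
    moreover have "e = E (retract (E w - e)) - (E w - e)"
      using originsD(2)[OF e] by (simp add: linear_diff[OF linear_retract])
    ultimately show "e \<in> L1 \<inter> (\<lambda>b. E (retract b) - b) ` X1"
      using originsD(1)[OF e] interior_subset by blast
  qed
  moreover have "linear (\<lambda>b. E (retract b) - b)"
    using linear_compose[OF linear_retract linear_coords]
    by (intro linear_compose_sub linear_ident) (simp add: comp_def)
  then have "bounded ((\<lambda>b. E (retract b) - b) ` X1)"
    using X1_top(1) by (intro bounded_linear_image compact_imp_bounded)
      (simp_all add: linear_conv_bounded_linear)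
  ultimately show ?thesis
    using finite_gauss_lattice_bounded finite_subset by blast
qed

lemma aff_dim_slice:
  assumes "e \<in> origins"
  shows "aff_dim (slice e) = 4"
proof -
  have "slice e = (+) (- e) ` E ` cell e"
    by (simp add: slice_def image_image)
  then have "aff_dim (slice e) = aff_dim (cell e)"
    by (simp only: aff_dim_translation_eq aff_dim_injective_linear_image[OF linear_coords inj_E])
  also have "\<dots> = 4"
    using aff_dim_nonempty_interior[OF interior_cell_nonempty[OF assms]] by simp
  finally show ?thesis .
qed

lemma closure_slice:
  assumes "e \<in> origins"
  shows "closure ((\<lambda>w. E w - e) ` interior (cell e)) = slice e"
proof -
  have eq: "(\<lambda>w. E w - e) ` A = (+) (- e) ` E ` A" for A
    by (simp add: image_image)
  have "closure (interior (cell e)) = cell e"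
    using convex_closure_interior[OF _ interior_cell_nonempty[OF assms]] polytope_cell[OF assms]
    by (simp add: polytope_imp_convex polytope_imp_closed)
  then show ?thesis
    unfolding eq slice_def closure_translation
    by (simp add: closure_injective_linear_image[OF linear_coords inj_E, symmetric])
qed

section \<open>Almost every point and its lifted images are good\<close>

lemma AE_good: "AE w in lborel. good w"
proof -
  have lin: "linear (\<lambda>w. V (E w) $ k)" for k
    by (intro linearI) (simp_all add: E_simps linear_add[OF linear_V] linear_scale[OF linear_V]
        linear_scale[OF linear_coords])
  have lin_Re: "linear (\<lambda>w. Re (V (E w) $ k))" and lin_Im: "linear (\<lambda>w. Im (V (E w) $ k))" for k
    using linear_add[OF lin[of k]] linear_scale[OF lin[of k]] by (auto intro!: linearI)
  \<comment> \<open>The walls of the pieces lie in countably many hyperplanes, which are null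
    because the genericity assumptions make the functionals nonzero.\<close>
  have "AE w in lborel. \<forall>e\<in>L1. \<forall>k\<in>UNIV. \<forall>t\<in>{1/2, -1/2}.
      Re (V (E w) $ k) \<noteq> t + Re (V e $ k) \<and> Im (V (E w) $ k) \<noteq> t + Im (V e $ k)"
  proof (intro AE_ball_countable' countable_gauss_lattice AE_conjI)
    fix k t and e :: "complex ^ 'n"
    show "AE w in lborel. Re (V (E w) $ k) \<noteq> t + Re (V e $ k)"
      using Re_generic[of k] AE_linear_neq[OF lin_Re] by blast
    show "AE w in lborel. Im (V (E w) $ k) \<noteq> t + Im (V e $ k)"
      using Im_generic[of k] AE_linear_neq[OF lin_Im] by blast
  qed auto
  then show ?thesis
  proof (rule AE_mp, intro AE_I2 impI)
    fix w
    assume *: "\<forall>e\<in>L1. \<forall>k\<in>UNIV. \<forall>t\<in>{1/2, -1/2}.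
      Re (V (E w) $ k) \<noteq> t + Re (V e $ k) \<and> Im (V (E w) $ k) \<noteq> t + Im (V e $ k)"
    \<comment> \<open>The closed domain supplies some \<open>e\<close>; off the walls all
      inequalities of the cube are strict.\<close>
    obtain e b where e: "e \<in> L1" and b: "b \<in> X1" "E w = e + b"
      using fd_X1_L1 unfolding fundamental_domain_def by blast
    have eb: "V b $ k = V (E w) $ k - V e $ k" for k
      by (simp add: b(2) linear_add[OF linear_V])
    have "V b \<in> unit_cube"
      using b(1) VP unfolding X1_def by auto
    moreover have "\<bar>Re (V b $ k)\<bar> \<noteq> 1/2" "\<bar>Im (V b $ k)\<bar> \<noteq> 1/2" for k
      using *[rule_format, OF e UNIV_I, of "1/2" k] *[rule_format, OF e UNIV_I, of "-1/2" k]
      by (auto simp: eb abs_if split: if_splits)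
    ultimately have "V b $ k \<in> open_square" for k
      unfolding unit_cube_def open_square_def by (simp add: order.strict_iff_order)
    then have "E w - e \<in> interior X1"
      by (simp add: interior_X1 b(2))
    then show "good w"
      using e unfolding good_def by blast
  qed
qed

text \<open>For fixed \<open>e\<close> the lift has linear part \<open>A\<close>, which
  \<open>E\<close> intertwines with \<open>N\<close>; hence \<open>A\<close> is an involution and
  \<open>AE_affine\<close> applies. Countability of \<open>L1\<close> handles all \<open>e\<close>
  at once.\<close>

lemma AE_step_lift:
  assumes "AE w in lborel. R w"
  shows "AE w in lborel. \<forall>e\<in>L1. R (step_lift e w)"
proof (intro AE_ball_countable' countable_gauss_lattice)
  fix e :: "complex ^ 'n"
  define A where "A w = w + \<nu> (E w)" for w
  have "linear (\<lambda>w. w + (\<nu> \<circ> E) w)"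
    by (intro linear_compose_add linear_ident linear_compose linear_\<nu> linear_coords)
  then have "linear A" by (simp add: A_def[abs_def])
  have EA: "E (A w) = N (E w)" for w
    by (simp add: A_def N_def E_simps)
  have "A (A w) = w" for w
    using injD[OF inj_E, of "A (A w)" w] by (simp add: EA)
  then have "AE w in lborel. R (A w + (- \<nu> e))"
    using assms \<open>linear A\<close> by (intro AE_affine)
  moreover have "A w + (- \<nu> e) = step_lift e w" for w
    by (simp add: A_def step_lift_def linear_diff[OF linear_\<nu>])
  ultimately show "AE w in lborel. R (step_lift e w)" by simp
qed

lemma good_iff: "good w \<longleftrightarrow> torus w \<in> open_pieces (cell ` origins)"
proof
  assume "good w"
  then obtain e where "e \<in> L1" "E w - e \<in> interior X1"
    unfolding good_def by blast
  then obtain l e0 where *: "l \<in> gauss2" "e0 \<in> origins" "E (w - l) - e0 \<in> interior X1"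
    using normalise_origin by metis
  then have "torus (w - l) \<in> open_pieces (cell ` origins)"
    unfolding open_pieces_def by (auto simp: interior_cell)
  moreover have "torus w = torus (w - l)"
    using *(1) by (simp add: torus_eq_iff)
  ultimately show "torus w \<in> open_pieces (cell ` origins)" by simp
next
  assume "torus w \<in> open_pieces (cell ` origins)"
  then obtain e w' where *: "e \<in> origins" "torus w = torus w'" "E w' - e \<in> interior X1"
    unfolding open_pieces_def by (auto simp: interior_cell)
  then have "e + E (w - w') \<in> L1" "E w - (e + E (w - w')) \<in> interior X1"
    using originsD(1) gauss_lattice_simps(2)[of e "E (w - w')"]
    by (simp_all add: E_in_gauss_lattice torus_eq_iff) (simp add: E_simps)
  then show "good w"
    unfolding good_def by blast
qed

lemma open_piecesE:
  assumes "p \<in> open_pieces (cell ` origins)"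
  obtains e w where "e \<in> origins" "p = torus w" "w \<in> interior (cell e)"
    "E w - e \<in> interior X1" "\<phi> p = E w - e"
  using assms originsD(1) unfolding open_pieces_def by (auto simp: interior_cell \<phi>_torus)

section \<open>The cells partition the torus\<close>

lemma closed_gauss2: "closed gauss2"
proof -
  have "gauss2 = E -` L1"
    by (auto simp: E_in_gauss_lattice)
  moreover have "closed (E -` L1)"
    by (intro closed_vimage closed_subset_gauss_lattice order_refl linear_continuous_on linear_coords
        linear_conv_bounded_linear[THEN iffD1])
  ultimately show ?thesis by simp
qed

lemma torus_partition_cells: "torus_partition (cell ` origins)"
  unfolding torus_partition_def
proof (intro conjI ballI impI)
  show "finite (cell ` origins)"
    by (simp add: finite_origins)
  fix S assume "S \<in> cell ` origins"
  then obtain e where e: "e \<in> origins" "S = cell e" by blast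
  then show "polytope S" "interior S \<noteq> {}"
    by (auto simp: polytope_cell interior_cell_nonempty)
  fix S' assume "S' \<in> cell ` origins" "S \<noteq> S'"
  then obtain e' where e': "e' \<in> origins" "S' = cell e'" "e \<noteq> e'"
    using e by blast
  then show "interior S \<inter> interior S' = {}"
    using X1_unique[OF originsD(1)[OF e(1)] originsD(1)[OF e'(1)]] interior_subset[of X1]
    unfolding e(2) e'(2) interior_cell[OF e(1)] interior_cell[OF e'(1)] by blast
next
  define U where "U = \<Union> (cell ` origins)"
  have "compact U"
    unfolding U_def by (intro compact_Union) (auto simp: finite_origins polytope_cell polytope_imp_compact)
  \<comment> \<open>Good points are dense and the translates of \<open>U\<close> form a closed set,
    so covering the good points suffices.\<close>
  have good: "{w. good w} \<subseteq> (\<Union>l\<in>gauss2. \<Union>x\<in>U. {l + x})"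
  proof safe
    fix w assume "good w"
    then obtain e' where e': "e' \<in> L1" "E w - e' \<in> interior X1"
      unfolding good_def by blast
    obtain l e where *: "l \<in> gauss2" "e \<in> origins" "E (w - l) - e = E w - e'"
      using normalise_origin[OF e'] .
    then have "w - l \<in> cell e"
      using e'(2) interior_subset[of X1] by (auto simp: cell_def)
    then have "w - l \<in> U"
      using *(2) unfolding U_def by blast
    then show "w \<in> (\<Union>l\<in>gauss2. \<Union>x\<in>U. {l + x})"
      using *(1) by (intro UN_I[of l] UN_I[of "w - l"]) auto
  qed
  have "closed (\<Union>l\<in>gauss2. \<Union>x\<in>U. {l + x})"
    by (intro closed_compact_sums closed_gauss2 \<open>compact U\<close>)
  then have cover: "(\<Union>l\<in>gauss2. \<Union>x\<in>U. {l + x}) = UNIV"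
    using closure_minimal[OF good] AE_lborel_imp_dense[OF AE_good] by auto
  have disj: "interior ((+) l ` U) \<inter> interior ((+) l' ` U) = {}"
    if l: "l \<in> gauss2" "l' \<in> gauss2" "l \<noteq> l'" for l l'
  proof (rule ccontr)
    assume ne: "interior ((+) l ` U) \<inter> interior ((+) l' ` U) \<noteq> {}" (is "?W \<noteq> {}")
    \<comment> \<open>By density an open overlap contains a good point, for which the translating
      vector is unique.\<close>
    have "?W \<inter> closure {w. good w} \<noteq> {}"
      using ne unfolding AE_lborel_imp_dense[OF AE_good] Int_UNIV_right .
    then have "?W \<inter> {w. good w} \<noteq> {}"
      unfolding open_Int_closure_eq_empty[OF open_Int[OF open_interior open_interior]] .
    then obtain w where "w \<in> ?W" "good w"
      by (force simp only: ex_in_conv[symmetric] Int_iff mem_Collect_eq)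
    then have w: "good w" "w \<in> (+) l ` U" "w \<in> (+) l' ` U"
      by (auto dest: subsetD[OF interior_subset])
    obtain e where e: "e \<in> L1" "E w - e \<in> interior X1"
      using w(1) unfolding good_def by blast
    \<comment> \<open>The \<open>e\<close> belonging to the good point \<open>w\<close> is unique
      and equals \<open>e0 + E k\<close>; \<open>retract\<close> kills \<open>e0\<close> and returns
      \<open>k\<close>.\<close>
    have *: "k = retract e" if k: "w \<in> (+) k ` U" "k \<in> gauss2" for k
    proof -
      obtain e0 where e0: "e0 \<in> origins" "w - k \<in> cell e0"
        using k(1) unfolding U_def by auto
      then have "E w - (e0 + E k) \<in> X1"
        by (simp add: cell_def E_simps algebra_simps)
      then have "e = e0 + E k"
        using e e0(1) k(2) originsD(1) by (intro X1_unique[of e _ w]) (auto simp: E_in_gauss_lattice)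
      then show ?thesis
        using originsD(2)[OF e0(1)] by (simp add: linear_add[OF linear_retract])
    qed
    show False
      using *[OF w(2) l(1)] *[OF w(3) l(2)] l(3) by simp
  qed
  show "fundamental_domain gauss2 (\<Union> (cell ` origins))"
    unfolding fundamental_domain_def U_def[symmetric]
  proof (intro conjI ballI impI)
    show "(\<Union>l\<in>gauss2. (+) l ` U) = UNIV"
      using cover by (simp add: UNION_singleton_eq_range)
  qed (rule disj)
qed

section \<open>The piecewise translation and the conjugacy\<close>

lemma piecewise_translation_\<phi>: "piecewise_translation (cell ` origins) \<phi>"
proof -
  have "(\<forall>w. E w $ j = fst w) \<or> (\<forall>w. E w $ j = snd w)" for j
    by (cases "c j") auto
  then have "repeating_coords E"
    unfolding repeating_coords_def using linear_coords inj_E by blast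
  moreover have "\<exists>v. \<forall>w\<in>interior S. \<phi> (torus w) = E w + v" if S: "S \<in> cell ` origins" for S
  proof -
    obtain e where e: "e \<in> origins" "S = cell e"
      using S by blast
    show ?thesis
      using e originsD(1) by (intro exI[of _ "- e"]) (auto simp: interior_cell \<phi>_torus)
  qed
  ultimately show ?thesis
    unfolding piecewise_translation_def using torus_partition_cells by blast
qed

lemma union_slices: "\<Union> (slice ` origins) = closure (\<phi> ` open_pieces (cell ` origins))"
proof -
  have "\<phi> ` open_pieces (cell ` origins) = (\<Union>e\<in>origins. (\<lambda>w. E w - e) ` interior (cell e))"
    unfolding open_pieces_def image_UN image_image
    using originsD(1) by (intro SUP_cong image_cong refl) (auto simp: interior_cell \<phi>_torus)
  moreover have "closure (\<Union>e\<in>origins. (\<lambda>w. E w - e) ` interior (cell e)) =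
      (\<Union>e\<in>origins. closure ((\<lambda>w. E w - e) ` interior (cell e)))"
    using finite_origins by (induction rule: finite_induct) simp_all
  ultimately show ?thesis
    by (simp add: closure_slice)
qed

lemma mem_\<phi>_image:
  assumes "e \<in> L1" "E w - e \<in> interior X1"
  shows "E w - e \<in> \<phi> ` open_pieces (cell ` origins)"
proof -
  have "torus w \<in> open_pieces (cell ` origins)"
    using assms unfolding good_iff[symmetric] good_def by blast
  then show ?thesis
    by (rule rev_image_eqI) (rule \<phi>_torus[OF assms, symmetric])
qed

text \<open>
  Slices have measure zero and limit points of the image of \<open>\<phi>\<close> may lie on the boundary of \<open>X1\<close>.
  However, wherever the PET is defined its value is interior, hence in the image of \<open>\<phi>\<close> itself.
\<close>

lemma invariant_slices: "invariant_under f (\<Union> (slice ` origins))"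
  unfolding invariant_under_def
proof
  fix q assume "q \<in> ran (f |` \<Union> (slice ` origins))"
  then obtain e w where e: "e \<in> origins" "f (E w - e) = Some q"
    by (auto simp: ran_def restrict_map_def slice_def split: if_splits)
  obtain e' e'' where "e'' \<in> L1" "q \<in> interior X1" "q = E (step_lift e' (step_lift e w)) - e''"
    using PET_SomeD[OF originsD(1)[OF e(1)] e(2)] .
  then have "q \<in> \<phi> ` open_pieces (cell ` origins)"
    using mem_\<phi>_image by blast
  then show "q \<in> \<Union> (slice ` origins)"
    unfolding union_slices by (rule subsetD[OF closure_subset])
qed

lemma inj_on_\<phi>: "inj_on \<phi> (open_pieces (cell ` origins))"
proof (rule inj_onI)
  fix p p' assume p: "p \<in> open_pieces (cell ` origins)" "p' \<in> open_pieces (cell ` origins)" "\<phi> p = \<phi> p'"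
  obtain e w where e: "e \<in> origins" "p = torus w" "\<phi> p = E w - e"
    using open_piecesE[OF p(1)] .
  obtain e' w' where e': "e' \<in> origins" "p' = torus w'" "\<phi> p' = E w' - e'"
    using open_piecesE[OF p(2)] .
  have "E (w - w') = e - e'"
    using e(3) e'(3) p(3) by (simp add: E_simps algebra_simps)
  then have "E (w - w') \<in> L1"
    using originsD(1) e(1) e'(1) by simp
  then show "p = p'"
    by (simp add: e(2) e'(2) torus_eq_iff E_in_gauss_lattice)
qed

lemma conjugates_\<phi>:
  "conjugates (cell ` origins) \<phi> (act s (of_word (hw @ hw))) f (\<Union> (slice ` origins))"
  unfolding conjugates_def
proof (intro conjI ballI impI)
  show "inj_on \<phi> (open_pieces (cell ` origins))"
    by (rule inj_on_\<phi>)
  show "closure (\<phi> ` open_pieces (cell ` origins)) = \<Union> (slice ` origins)"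
    by (rule union_slices[symmetric])
next
  fix p q assume p: "p \<in> open_pieces (cell ` origins)"
    and *: "act s (of_word (hw @ hw)) p = Some q \<and> \<phi> p \<in> dom f"
  obtain e w where e: "e \<in> origins" "p = torus w" "E w - e \<in> interior X1" "\<phi> p = E w - e"
    using open_piecesE[OF p] .
  then obtain r where r: "f (E w - e) = Some r"
    using * by auto
  obtain e' e'' where e': "e' \<in> L1" "e'' \<in> L1" "E (step_lift e w) - e' \<in> interior X1"
    "r \<in> interior X1" "r = E (step_lift e' (step_lift e w)) - e''"
    using PET_SomeD[OF originsD(1)[OF e(1)] r] .
  \<comment> \<open>The \<open>e'\<close> extracted from the PET also serves for the second
    application of the word, so both sides use the same lifts.\<close>
  have "q = torus (step_lift e' (step_lift e w))"
    using * act_torus[OF originsD(1)[OF e(1)] e'(1) e(3) e'(3)] e(2) by simp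
  then have "\<phi> q = r"
    using \<phi>_torus[OF e'(2)] e'(4,5) by simp
  then show "f (\<phi> p) = Some (\<phi> q)"
    using r e(4) by simp
next
  \<comment> \<open>Start, midpoint and end of the orbit must be good; \<open>e\<close> and
    \<open>e'\<close> depend on \<open>w\<close>, hence the quantifiers over all of
    \<open>L1\<close>.\<close>
  have "AE w in lborel. good w \<and> (\<forall>e\<in>L1. good (step_lift e w)) \<and>
      (\<forall>e\<in>L1. \<forall>e'\<in>L1. good (step_lift e' (step_lift e w)))"
    by (intro AE_conjI AE_good AE_step_lift)
  then show "AE w in lborel. torus w \<in> open_pieces (cell ` origins) \<and>
      (\<exists>q\<in>open_pieces (cell ` origins). act s (of_word (hw @ hw)) (torus w) = Some q) \<and>
      \<phi> (torus w) \<in> dom f"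
  proof (rule AE_mp, intro AE_I2 impI)
    fix w
    assume *: "good w \<and> (\<forall>e\<in>L1. good (step_lift e w)) \<and>
      (\<forall>e\<in>L1. \<forall>e'\<in>L1. good (step_lift e' (step_lift e w)))"
    then obtain e where e: "e \<in> L1" "E w - e \<in> interior X1"
      unfolding good_def by blast
    then obtain e' where e': "e' \<in> L1" "E (step_lift e w) - e' \<in> interior X1"
      using * unfolding good_def by blast
    have good: "good (step_lift e' (step_lift e w))"
      using * e(1) e'(1) by blast
    then obtain e'' where e'': "e'' \<in> L1" "E (step_lift e' (step_lift e w)) - e'' \<in> interior X1"
      unfolding good_def by blast
    have "act s (of_word (hw @ hw)) (torus w) = Some (torus (step_lift e' (step_lift e w)))"
      by (rule act_torus[OF e(1) e'(1) e(2) e'(2)])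
    moreover have "\<phi> (torus w) \<in> dom f"
      using PET_SomeI[OF e(1) e'(1) e''(1) e(2) e'(2) e''(2)] \<phi>_torus[OF e] by auto
    ultimately show "torus w \<in> open_pieces (cell ` origins) \<and>
      (\<exists>q\<in>open_pieces (cell ` origins). act s (of_word (hw @ hw)) (torus w) = Some q) \<and>
      \<phi> (torus w) \<in> dom f"
      using * good good_iff by blast
  qed
qed

lemma conjugate_to_PET:
  "\<exists>(X1 :: (complex ^ 'n) set) X2 L1 L2 YY PP \<phi>.
     double_lattice X1 X2 L1 L2 \<and>
     finite YY \<and> (\<forall>S\<in>YY. polytope S \<and> aff_dim S = 4) \<and> \<Union>YY \<subseteq> X1 \<and>
     invariant_under (double_lattice_PET X1 X2 L1 L2) (\<Union>YY) \<and>
     piecewise_translation PP \<phi> \<and>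
     conjugates PP \<phi> (act s (of_word (hw @ hw))) (double_lattice_PET X1 X2 L1 L2) (\<Union>YY)"
proof (intro exI conjI)
  show "double_lattice X1 X2 L1 L2" by (rule double_lattice_X)
  show "finite (slice ` origins)" by (simp add: finite_origins)
  show "\<forall>S\<in>slice ` origins. polytope S \<and> aff_dim S = 4"
    by (auto simp: polytope_slice aff_dim_slice)
  show "\<Union> (slice ` origins) \<subseteq> X1"
    by (auto simp: slice_def cell_def)
  show "invariant_under f (\<Union> (slice ` origins))" by (rule invariant_slices)
  show "piecewise_translation (cell ` origins) \<phi>" by (rule piecewise_translation_\<phi>)
  show "conjugates (cell ` origins) \<phi> (act s (of_word (hw @ hw))) f (\<Union> (slice ` origins))"
    by (rule conjugates_\<phi>)
qed

end

section \<open>Words in the square turning maps\<close>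

text \<open>
  Needed for words in a single letter, whose square is trivial in the group: for them the
  coordinates read off from the word would not give an injective map.
\<close>

lemma conjugate_to_PET_Nil:
  assumes "CARD('n::finite) \<ge> 2"
  shows "\<exists>(X1 :: (complex ^ 'n) set) X2 L1 L2 YY PP \<phi>.
     double_lattice X1 X2 L1 L2 \<and>
     finite YY \<and> (\<forall>S\<in>YY. polytope S \<and> aff_dim S = 4) \<and> \<Union>YY \<subseteq> X1 \<and>
     invariant_under (double_lattice_PET X1 X2 L1 L2) (\<Union>YY) \<and>
     piecewise_translation PP \<phi> \<and>
     conjugates PP \<phi> (act s (of_word [])) (double_lattice_PET X1 X2 L1 L2) (\<Union>YY)"
proof -
  obtain j1 j2 :: 'n where j: "j1 \<noteq> j2"
  proof -
    have "\<not> is_singleton (UNIV :: 'n set)"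
      using assms by (simp add: is_singleton_altdef)
    then show ?thesis
      using that by (metis UNIV_I UNIV_eq_I empty_not_UNIV is_singletonI singleton_iff)
  qed
  define c where "c k = (if k = j1 then A1 else A2)" for k
  have fd: "fundamental_domain gauss_lattice ((\<lambda>x. x) ` (unit_cube :: (complex ^ 'n) set))"
    by (rule triangular_fundamental_domain[where a = 1 and r = "\<lambda>_. 0" and M = "\<lambda>_ _. 0"])
      (simp_all add: linear_ident)
  have turned: "turned_coord a (t, t) = t" for a t
    by (cases a) simp_all
  \<comment> \<open>The trivial datum: \<open>P\<close> and \<open>N\<close> are the identity, both
    polytopes the unit cube, both lattices the Gaussian vectors.\<close>
  interpret turning_PET s c j1 j2 "\<lambda>x. x" "\<lambda>x. x" "\<lambda>_. 0" "[]"
  proof (rule turning_PET.intro)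
    show "linear (\<lambda>_ :: complex ^ 'n. 0 :: complex \<times> complex)"
      by (rule linear_zero)
    show "\<exists>w. Re (coords c w $ k) \<noteq> 0" for k
      by (rule exI[of _ "(1, 1)"]) (simp add: turned)
    show "\<exists>w. Im (coords c w $ k) \<noteq> 0" for k
      by (rule exI[of _ "(\<i>, \<i>)"]) (simp add: turned)
  qed (use fd j in \<open>simp_all add: c_def linear_ident linear_0[OF linear_coords]\<close>)
  show ?thesis
    using conjugate_to_PET by simp
qed

section \<open>Square turning as motion along a complex line\<close>

fun side :: "real \<Rightarrow> gen \<Rightarrow> complex" where
  "side s A1 = 1"
| "side s A2 = of_real s"

text \<open>The common direction of all turns: either letter moves a suitable lift along the complex
  line through \<open>(1, 1/s)\<close>, so the displacement of a word is a single complex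
  number.\<close>

definition along :: "real \<Rightarrow> complex \<Rightarrow> complex \<times> complex" where
  "along s t = (t, t / of_real s)"

lemma turned_coord_along: "turned_coord a (along s t) = t / side s a"
  by (cases a) (simp_all add: along_def)

lemma along_add: "along s (t + t') = along s t + along s t'"
  by (simp add: along_def add_divide_distrib)

text \<open>Modulo Gaussian integers the turned coordinate passes from \<open>x\<close> to
  \<open>\<i> * x\<close>, a change by \<open>(\<i> - 1) * x\<close>, and the shear adds the
  matching multiple to the other coordinate.\<close>

lemma turn_along:
  assumes "s \<noteq> 0" "x \<in> open_square"
    and "Re (turned_coord a w - x) \<in> \<int>" "Im (turned_coord a w - x) \<in> \<int>"
  shows "turn s a (torus w) = Some (torus (w + along s ((\<i> - 1) * (side s a * x))))"
proof -
  obtain p q where w: "w = (p, q)" by (cases w)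
  define w' where "w' = (case a of A1 \<Rightarrow> (x, q) | A2 \<Rightarrow> (p, x))"
  have "torus w = torus w'"
    using assms(3,4) by (cases a) (simp_all add: torus_eq_iff gauss2_def w w'_def)
  moreover have "turn s a (torus w') = Some (torus (turn_lift s a w'))"
    using assms(2) by (intro turn_torus) (cases a; simp add: w'_def)
  moreover have "w + along s ((\<i> - 1) * (side s a * x)) - turn_lift s a w' \<in> gauss2"
    using assms(1,3,4)
    by (cases a) (simp_all add: gauss2_def w w'_def along_def algebra_simps diff_divide_distrib)
  then have "torus (turn_lift s a w') = torus (w + along s ((\<i> - 1) * (side s a * x)))"
    by (simp add: torus_eq_iff[symmetric])
  ultimately show ?thesis by simp
qed

lemma i_power_4m2: "\<i> ^ (4 * m + 2) = - 1"
  by (simp add: power_add power_mult)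

section \<open>Displacement sums of a word\<close>

locale turning_word =
  fixes s :: real and xs :: "gen list" and r :: "'n::finite \<Rightarrow> nat" and m :: nat
  assumes s: "s > 0" and length_xs: "length xs = 4 * m + 2"
    and r: "bij_betw r UNIV {..<4 * m + 2}"
    and letters: "A1 \<in> set xs" "A2 \<in> set xs"
begin

abbreviation n :: nat where
  "n \<equiv> 4 * m + 2"

text \<open>\<open>r k\<close> is the time at which index \<open>k\<close> is turned;
  \<open>rev\<close> is there because \<open>word_map\<close> applies the last letter first.\<close>

definition c :: "'n \<Rightarrow> gen" where
  "c k = rev xs ! r k"

abbreviation d :: "'n \<Rightarrow> complex" where
  "d k \<equiv> side s (c k)"

text \<open>If \<open>x\<close> lists the turned representatives, \<open>(\<i> - 1) * S K x\<close>
  is the displacement after \<open>K\<close> letters.\<close>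

definition S :: "nat \<Rightarrow> complex ^ 'n \<Rightarrow> complex" where
  "S K x = (\<Sum>j | r j < K. d j * x $ j)"

text \<open>The sum \<open>S K x\<close> in terms of \<open>b = P x\<close>, for
  \<open>K \<le> n\<close> (\<open>\<sigma>_P\<close>); the powers of \<open>\<i>\<close> come from
  inverting \<open>P\<close>.\<close>

definition \<sigma> :: "nat \<Rightarrow> complex ^ 'n \<Rightarrow> complex" where
  "\<sigma> K b = (\<Sum>j | r j < K. \<i> ^ (K - Suc (r j)) * (d j * b $ j))"

text \<open>Undoes the displacement made before time \<open>r k\<close>: representatives become
  initial coordinates up to a Gaussian vector.\<close>

definition P :: "complex ^ 'n \<Rightarrow> complex ^ 'n" where
  "P x = (\<chi> k. x $ k - (\<i> - 1) * S (r k) x / d k)"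

definition V :: "complex ^ 'n \<Rightarrow> complex ^ 'n" where
  "V = inv_into UNIV P"

definition \<nu> :: "complex ^ 'n \<Rightarrow> complex \<times> complex" where
  "\<nu> b = along s ((\<i> - 1) * \<sigma> n b)"

lemma d_nonzero [simp]: "d k \<noteq> 0"
  using s by (cases "c k") simp_all

lemma r_less: "r k < n"
  using r by (auto simp: bij_betw_def)

lemmas [simp] = r_less r_less[simplified]

lemma r_surj:
  assumes "K < n"
  obtains k where "r k = K"
  using assms r by (metis bij_betw_iff_bijections lessThan_iff)

lemma inj_r: "inj r"
  using r by (simp add: bij_betw_def)

lemma less_Suc_r: "{j. r j < Suc (r k)} = insert k {j. r j < r k}"
  using inj_r by (auto simp: less_Suc_eq inj_eq)

lemma S_Suc: "S (Suc (r k)) x = S (r k) x + d k * x $ k"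
  unfolding S_def less_Suc_r by simp

lemma S_0: "S 0 x = 0"
  by (simp add: S_def)

lemma \<sigma>_Suc: "\<sigma> (Suc (r k)) b = \<i> * \<sigma> (r k) b + d k * b $ k"
proof -
  have "\<i> ^ (Suc (r k) - Suc (r j)) = \<i> * \<i> ^ (r k - Suc (r j))" if "r j < r k" for j
    using that by (simp add: Suc_diff_Suc flip: power_Suc)
  then show ?thesis
    unfolding \<sigma>_def less_Suc_r by (simp add: sum_distrib_left mult.assoc)
qed

lemma \<sigma>_0: "\<sigma> 0 x = 0"
  by (simp add: \<sigma>_def)

lemma r_induct [consumes 1, case_names 0 Suc]:
  assumes "K \<le> n" and "Q 0" and Suc: "\<And>k. Q (r k) \<Longrightarrow> Q (Suc (r k))"
  shows "Q K"
  using \<open>K \<le> n\<close>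
proof (induction K)
  case (Suc K)
  then obtain k where "r k = K"
    using r_surj[of K] by auto
  then show ?case
    using assms(3)[of k] Suc by simp
qed (rule assms(2))

lemma S_linear: "S K (x + y) = S K x + S K y" "S K (t *\<^sub>R x) = of_real t * S K x"
  by (simp_all add: S_def sum.distrib sum_distrib_left algebra_simps scaleR_conv_of_real[where 'a = complex])

lemma \<sigma>_linear: "\<sigma> K (x + y) = \<sigma> K x + \<sigma> K y" "\<sigma> K (t *\<^sub>R x) = of_real t * \<sigma> K x"
  by (simp_all add: \<sigma>_def sum.distrib sum_distrib_left algebra_simps scaleR_conv_of_real[where 'a = complex])

section \<open>The coordinate change and its fundamental domains\<close>

lemma linear_P: "linear P"
  by (intro linearI)
    (simp_all add: P_def vec_eq_iff S_linear algebra_simps add_divide_distrib diff_divide_distrib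
      scaleR_conv_of_real[where 'a = complex])

lemma linear_\<nu>: "linear \<nu>"
  by (intro linearI)
    (simp_all add: \<nu>_def along_def \<sigma>_linear algebra_simps add_divide_distrib diff_divide_distrib
      scaleR_conv_of_real[where 'a = complex])

lemma P_triangular:
  "P x $ k = 1 * x $ k + (\<Sum>j | r j < r k. (- (\<i> - 1) * d j / d k) * x $ j)"
proof -
  have "(\<i> - 1) * S (r k) x / d k = (\<Sum>j | r j < r k. (\<i> - 1) * d j / d k * x $ j)"
    unfolding S_def by (simp add: sum_distrib_left sum_divide_distrib field_simps)
  then show ?thesis
    unfolding P_def by (simp add: left_diff_distrib diff_divide_distrib sum_subtractf)
qed

lemma inj_P: "inj P"
  by (rule triangular_inj[where T = P and a = 1 and r = r, OF linear_P _ P_triangular]) simp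

lemma VP: "V (P x) = x"
  unfolding V_def by (rule inv_into_f_f[OF inj_P UNIV_I])

lemma PV: "P (V b) = b"
  unfolding V_def using linear_inj_imp_surj[OF linear_P inj_P] by (simp add: f_inv_into_f)

lemma linear_V: "linear V"
proof (rule linearI)
  show "V (x + y) = V x + V y" for x y
    using VP[of "V x + V y"] by (simp add: linear_add[OF linear_P] PV)
  show "V (t *\<^sub>R x) = t *\<^sub>R V x" for t x
    using VP[of "t *\<^sub>R V x"] by (simp add: linear_scale[OF linear_P] PV)
qed

text \<open>Both sides obey the same recursion: \<open>\<i> * S\<close> from
  \<open>\<sigma>_Suc\<close> and \<open>- (\<i> - 1) * S\<close> from \<open>P\<close> combine to
  \<open>S\<close>.\<close>

lemma \<sigma>_P:
  assumes "K \<le> n"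
  shows "\<sigma> K (P x) = S K x"
  using assms
proof (induction K rule: r_induct)
  case (Suc k)
  have "d k * P x $ k = d k * x $ k - (\<i> - 1) * S (r k) x"
    by (simp add: P_def right_diff_distrib)
  then show ?case
    by (simp add: \<sigma>_Suc S_Suc Suc left_diff_distrib)
qed (simp add: \<sigma>_0 S_0)

text \<open>Each coordinate weighted by \<open>d\<close> equals \<open>t\<close>, which leaves a
  geometric sum in \<open>\<i>\<close>.\<close>

lemma \<sigma>_along:
  assumes "K \<le> n"
  shows "(\<i> - 1) * \<sigma> K (coords c (along s t)) = (\<i> ^ K - 1) * t"
  using assms
proof (induction K rule: r_induct)
  case (Suc k)
  have "(\<i> - 1) * \<sigma> (Suc (r k)) (coords c (along s t)) =
      \<i> * ((\<i> - 1) * \<sigma> (r k) (coords c (along s t))) + (\<i> - 1) * t"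
    by (simp add: \<sigma>_Suc turned_coord_along algebra_simps)
  also have "\<dots> = (\<i> ^ Suc (r k) - 1) * t"
    unfolding Suc by (simp add: algebra_simps)
  finally show ?case .
qed (simp add: \<sigma>_0)

text \<open>The length of the word enters here, through \<open>\<i> ^ (4m + 2) = -1\<close>.\<close>

lemma \<nu>_invol: "\<nu> (b + coords c (\<nu> b)) = - \<nu> b"
proof -
  have "(\<i> - 1) * \<sigma> n (b + coords c (\<nu> b)) = - ((\<i> - 1) * \<sigma> n b)"
    unfolding \<sigma>_linear distrib_left \<nu>_def \<sigma>_along[OF order_refl] i_power_4m2
    by (simp add: algebra_simps)
  then show ?thesis
    unfolding \<nu>_def by (simp add: along_def)
qed

text \<open>Adding the full sum \<open>S n x\<close> cancels the earlier terms in row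
  \<open>k\<close> of \<open>P\<close> and leaves the later ones; the diagonal becomes
  \<open>1 + (\<i> - 1) = \<i>\<close>. The rank \<open>n - r j\<close> reverses time.\<close>

lemma NP_triangular:
  "(P x + coords c (\<nu> (P x))) $ k =
    \<i> * x $ k + (\<Sum>j | n - r j < n - r k. ((\<i> - 1) * d j / d k) * x $ j)"
proof -
  have later: "{j. n - r j < n - r k} = {j. r k < r j}"
    using r_less[of k] by (auto simp: less_diff_iff diff_less_mono2)
  have all: "{j. r j < n} = {j. r j < Suc (r k)} \<union> {j. r k < r j}"
    using r_less[of k] by auto
  have "S n x = S (Suc (r k)) x + (\<Sum>j | r k < r j. d j * x $ j)"
    unfolding S_def all by (rule sum.union_disjoint) auto
  then have S: "S n x = S (r k) x + d k * x $ k + (\<Sum>j | r k < r j. d j * x $ j)"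
    by (simp add: S_Suc)
  have "(\<Sum>j | r k < r j. ((\<i> - 1) * d j / d k) * x $ j) =
      (\<i> - 1) * (\<Sum>j | r k < r j. d j * x $ j) / d k"
    by (simp add: sum_distrib_left sum_divide_distrib field_simps)
  moreover have "(P x + coords c (\<nu> (P x))) $ k =
      x $ k - (\<i> - 1) * S (r k) x / d k + (\<i> - 1) * S n x / d k"
    by (simp only: vector_add_component coords_nth \<nu>_def turned_coord_along \<sigma>_P[OF order_refl])
      (simp only: P_def vec_lambda_beta)
  ultimately show ?thesis
    unfolding later S
    by (simp add: distrib_left add_divide_distrib left_diff_distrib diff_divide_distrib)
qed

lemma fd1: "fundamental_domain gauss_lattice (P ` unit_cube)"
  by (rule triangular_fundamental_domain[where T = P and a = 1 and r = r, OF linear_P _ P_triangular])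
    simp

lemma fd2: "fundamental_domain gauss_lattice ((\<lambda>b. b + coords c (\<nu> b)) ` P ` unit_cube)"
proof -
  have "linear (\<lambda>x. P x + (coords c \<circ> \<nu> \<circ> P) x)"
    by (intro linear_compose_add linear_compose linear_P linear_\<nu> linear_coords)
  then have lin: "linear (\<lambda>x. P x + coords c (\<nu> (P x)))"
    by (simp add: comp_def)
  show ?thesis
    unfolding image_image
    by (rule triangular_fundamental_domain[where a = \<i> and r = "\<lambda>k. n - r k", OF lin _ NP_triangular])
      simp
qed

text \<open>An explicit \<open>x\<close> is checked against \<open>P\<close>, the sums
  \<open>S K x\<close> being geometric. As \<open>t\<close> is arbitrary, every coordinate of
  \<open>V \<circ> coords c\<close> is onto, which gives genericity.\<close>

lemma V_along: "V (coords c (along s t)) $ k = \<i> ^ r k * t / d k"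
proof -
  define x where "x = (\<chi> k. \<i> ^ r k * t / d k)"
  have S: "(\<i> - 1) * S K x = (\<i> ^ K - 1) * t" if "K \<le> n" for K
    using that
  proof (induction K rule: r_induct)
    case (Suc k)
    have "(\<i> - 1) * S (Suc (r k)) x = (\<i> - 1) * S (r k) x + (\<i> - 1) * (\<i> ^ r k * t)"
      by (simp add: S_Suc x_def algebra_simps)
    then show ?case
      unfolding Suc by (simp add: algebra_simps)
  qed (simp add: S_0)
  have "P x $ k = coords c (along s t) $ k" for k
    using S[of "r k"] r_less[of k]
    by (simp add: P_def turned_coord_along less_imp_le) (simp add: x_def field_simps)
  then have "P x = coords c (along s t)"
    by (simp add: vec_eq_iff)
  then show ?thesis
    using VP[of x] by (simp add: x_def)
qed

text \<open>\<open>V (coords c w - e)\<close> lists the representatives in the square, so each turn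
  acts by \<open>turn_along\<close> and the displacements add up.\<close>

lemma word_map_prefix:
  assumes e: "e \<in> gauss_lattice" and x: "\<forall>k. V (coords c w - e) $ k \<in> open_square" and "K \<le> n"
  shows "word_map s (rev (take K (rev xs))) (torus w) =
    Some (torus (w + along s ((\<i> - 1) * S K (V (coords c w - e)))))"
  using \<open>K \<le> n\<close>
proof (induction K rule: r_induct)
  case 0
  show ?case by (simp add: S_0 along_def flip: zero_prod_def)
next
  case (Suc k)
  define x where "x = V (coords c w - e)"
  define w' where "w' = w + along s ((\<i> - 1) * S (r k) x)"
  have take: "rev (take (Suc (r k)) (rev xs)) = c k # rev (take (r k) (rev xs))"
    by (simp add: take_Suc_conv_app_nth length_xs c_def)
  \<comment> \<open>The displacement so far, seen in the coordinate about to be turned; by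
    \<open>PV\<close> that coordinate now differs from \<open>x $ k\<close> by the Gaussian integer
    \<open>e $ k\<close>.\<close>
  define q where "q = (\<i> - 1) * S (r k) x / d k"
  have "x $ k - q = P x $ k"
    by (simp add: P_def q_def)
  also have "\<dots> = turned_coord (c k) w - e $ k"
    by (simp add: x_def PV)
  finally have "turned_coord (c k) w + q - x $ k = e $ k"
    by (simp add: algebra_simps)
  then have "turned_coord (c k) w' - x $ k = e $ k"
    by (simp add: w'_def turned_coord_along q_def)
  then have "turn s (c k) (torus w') = Some (torus (w' + along s ((\<i> - 1) * (d k * x $ k))))"
    using s e x by (intro turn_along) (simp_all add: x_def gauss_lattice_def)
  moreover have "w' + along s ((\<i> - 1) * (d k * x $ k)) =
      w + along s ((\<i> - 1) * S (Suc (r k)) x)"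
    by (simp add: w'_def S_Suc distrib_left along_add)
  ultimately show ?case
    using Suc unfolding take x_def[symmetric] w'_def[symmetric] by simp
qed

lemma word_map_torus_xs:
  assumes "e \<in> gauss_lattice" "\<forall>k. V (coords c w - e) $ k \<in> open_square"
  shows "word_map s xs (torus w) = Some (torus (w + \<nu> (coords c w - e)))"
  using word_map_prefix[OF assms order_refl] \<sigma>_P[of n "V (coords c w - e)"]
  by (simp add: length_xs \<nu>_def PV)

lemma c_surj: "\<exists>k. c k = a"
proof -
  have "a \<in> set (rev xs)"
    using letters by (cases a) auto
  then obtain i where i: "i < n" "rev xs ! i = a"
    unfolding in_set_conv_nth length_rev length_xs by blast
  moreover obtain k where "r k = i"
    using r_surj[OF i(1)] .
  ultimately show ?thesis
    unfolding c_def by blast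
qed

lemma V_generic: "\<exists>w. V (coords c w) $ k = t"
proof -
  \<comment> \<open>The factor \<open>(- \<i>) ^ r k\<close> in the witness cancels the rotation in
    \<open>V_along\<close>.\<close>
  have "\<i> ^ r k * ((- \<i>) ^ r k * (t * d k)) = t * d k"
    by (simp flip: mult.assoc power_mult_distrib)
  then show ?thesis
    by (intro exI[of _ "along s ((- \<i>) ^ r k * (t * d k))"]) (simp add: V_along)
qed

lemma turning_PET_word:
  assumes "c j1 = A1" "c j2 = A2"
  shows "turning_PET s c j1 j2 P V \<nu> xs"
proof (rule turning_PET.intro)
  show "b + coords c (\<nu> b) + coords c (\<nu> (b + coords c (\<nu> b))) = b" for b
    unfolding \<nu>_invol by (simp add: linear_neg[OF linear_coords])
  show "\<exists>w. Re (V (coords c w) $ k) \<noteq> 0" for k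
    using V_generic[of k 1] by (metis one_complex.sel(1) zero_neq_one)
  show "\<exists>w. Im (V (coords c w) $ k) \<noteq> 0" for k
    using V_generic[of k \<i>] by (metis imaginary_unit.sel(2) zero_neq_one)
qed (fact assms linear_P linear_V linear_\<nu> VP PV fd1 fd2 | erule (1) word_map_torus_xs)+

end

section \<open>Reduction of the group element to words\<close>

lemma of_word_replicate_4: "of_word (replicate (4 * k) a) = of_word []"
proof (induction k)
  case (Suc k)
  have "replicate (4 * Suc k) a = [] @ replicate 4 a @ replicate (4 * k) a"
    by (simp add: replicate_add[symmetric])
  then show ?case
    using word_eq_step[of "[]" a "replicate (4 * k) a"] Suc by (metis append_Nil z4z4.abs_eq_iff)
qed simp

theorem corollary1p8:
  fixes s :: real and m :: nat and g h :: z4z4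
  assumes "s > 0" and "s \<notin> \<rat>"
    and "g \<in> G0" and "g = h [^]\<^bsub>G\<^esub> (2::nat)"
    and "has_word_length h (4 * m + 2)"
    and "CARD('n::finite) = 4 * m + 2"
  shows "\<exists>(X1 :: (complex ^ 'n) set) X2 L1 L2 YY PP \<phi>.
           double_lattice X1 X2 L1 L2 \<and>
           finite YY \<and> (\<forall>S\<in>YY. polytope S \<and> aff_dim S = 4) \<and> \<Union>YY \<subseteq> X1 \<and>
           invariant_under (double_lattice_PET X1 X2 L1 L2) (\<Union>YY) \<and>
           piecewise_translation PP \<phi> \<and>
           conjugates PP \<phi> (act s g) (double_lattice_PET X1 X2 L1 L2) (\<Union>YY)"
proof -
  have h: "h \<in> carrier G"
    by (simp add: G_def)
  obtain xs where xs: "length xs = 4 * m + 2" "h = of_word xs"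
    using assms(5) unfolding has_word_length_def by blast
  have "g = h \<otimes>\<^bsub>G\<^esub> h"
    unfolding assms(4) using monoid.l_one[OF group.is_monoid[OF group_G] h]
    by (simp add: numeral_2_eq_2 monoid.nat_pow_Suc monoid.nat_pow_0 group.is_monoid[OF group_G])
  then have g: "g = of_word (xs @ xs)"
    by (simp add: xs(2) of_word_append)
  show ?thesis
  proof (cases "A1 \<in> set xs \<and> A2 \<in> set xs")
    case True
    obtain r :: "'n \<Rightarrow> nat" where "bij_betw r UNIV {..<4 * m + 2}"
      using ex_bij_betw_finite_nat[of "UNIV :: 'n set"] assms(6) by (auto simp: atLeast0LessThan)
    then interpret turning_word s xs r m
      using assms(1) xs(1) True by unfold_locales auto
    obtain j1 j2 where "c j1 = A1" "c j2 = A2"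
      using c_surj by metis
    then show ?thesis
      unfolding g by (intro turning_PET.conjugate_to_PET[OF turning_PET_word])
  next
    case False
    then obtain a where "\<forall>b\<in>set xs. b = a"
      by (metis gen.exhaust)
    then have "xs = replicate (4 * m + 2) a"
      using xs(1) by (metis replicate_length_same)
    then have "xs @ xs = replicate ((4 * m + 2) + (4 * m + 2)) a"
      by (simp only: replicate_add)
    \<comment> \<open>Twice the length is a multiple of four, so the square of a one-letter word is
      trivial.\<close>
    also have "(4 * m + 2) + (4 * m + 2) = 4 * (2 * m + 1)"
      by simp
    finally have "xs @ xs = replicate (4 * (2 * m + 1)) a" .
    then have "g = of_word []"
      unfolding g by (simp only: of_word_replicate_4)
    then show ?thesis
      using conjugate_to_PET_Nil[where 'n = 'n and s = s] assms(6) by simp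
  qed
qed

end
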